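(* Let $n,t\ge 1$ be integers and $\mathbb R[X]:=\mathbb R[X_1,\ldots,X_n]$. Let $1\le m\le k$ be integers and let $G=\{g_1,\ldots,g_k\}\subseteq\mathbb R[X]$ be such that $g_1,\ldots,g_m$ are linear (i.e. of degree at most $1$, constant terms allowed). Put $\hat G=\{g_1,\ldots,g_m\}$ and suppose that $K(\hat G)$ is non-empty and compact. Let $\mathbf F\in\mathcal S_t(\mathbb R[X])$. If $\mathbf F(x)>0$ (positive definite) for all $x\in K(G)$, then $\mathbf F\in P(G)^t$, i.e. $\mathbf F$ can be written as $$\mathbf F=\sum_{i=1}^r\Big(\sum_{j=1}^s a_{\alpha_{ij}}\,g^{\alpha_{ij}}\Big)\mathbf A_i^T\mathbf A_i,$$ with $\alpha_{ij}\in\mathbb N_0^k$, real numbers $a_{\alpha_{ij}}\ge 0$, $g^{\alpha_{ij}}:=g_1^{(\alpha_{ij})_1}\cdots g_k^{(\alpha_{ij})_k}$ and $\mathbf A_i\in\mathcal M_t(\mathbb R[X])$.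
   Context: $\mathcal M_t(\mathbb R[X])$ is the algebra of $t\times t$ matrices with entries in $\mathbb R[X]$, and $\mathcal S_t(\mathbb R[X])$ its subset of symmetric matrices. For $H\subseteq\mathbb R[X]$, $K(H)=\{x\in\mathbb R^n : h(x)\ge 0\ \forall h\in H\}$. For $G=\{g_1,\dots,g_k\}$, $P(G)$ is the semiring generated by $G$: the set of finite sums of terms $a_\alpha g_1^{\alpha_1}\cdots g_k^{\alpha_k}$ with $\alpha\in\mathbb N_0^k$ and real $a_\alpha\ge 0$. For a semiring $M\subseteq\mathbb R[X]$, $M^t$ is the set of all finite sums $\sum_i m_i\mathbf A_i^T\mathbf A_i$ with $m_i\in M$ and $\mathbf A_i\in\mathcal M_t(\mathbb R[X])$. *)

theory Defs
  imports "HOL-Analysis.Analysis" "HOL-Library.Poly_Mapping"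
begin

text \<open>
  A polynomial over the reals in finitely many variables indexed by \<open>'v\<close> is a finitely supported
  map from exponent vectors (themselves finitely supported maps \<open>'v \<Rightarrow>\<^sub>0 nat\<close>) to coefficients; the
  ring structure is the convolution product of \<open>Poly_Mapping\<close>.
\<close>

type_synonym 'v rpoly = "('v \<Rightarrow>\<^sub>0 nat) \<Rightarrow>\<^sub>0 real"

definition const_poly :: "real \<Rightarrow> 'v rpoly" where
  "const_poly c = Poly_Mapping.single 0 c"

definition eval_poly :: "'v::finite rpoly \<Rightarrow> real ^ 'v \<Rightarrow> real" where
  "eval_poly p x =
    (\<Sum>e\<in>Poly_Mapping.keys p. Poly_Mapping.lookup p e * (\<Prod>i\<in>UNIV. (x $ i) ^ Poly_Mapping.lookup e i))"

text \<open>The zero polynomial gets total degree 0.\<close>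

definition total_degree :: "'v::finite rpoly \<Rightarrow> nat" where
  "total_degree p =
    Max (insert 0 ((\<lambda>e. \<Sum>i\<in>UNIV. Poly_Mapping.lookup e i) ` Poly_Mapping.keys p))"

definition nonneg_set :: "'v::finite rpoly set \<Rightarrow> (real ^ 'v) set" where
  "nonneg_set H = {x. \<forall>h\<in>H. eval_poly h x \<ge> 0}"

definition power_product :: "nat \<Rightarrow> (nat \<Rightarrow> 'v rpoly) \<Rightarrow> (nat \<Rightarrow> nat) \<Rightarrow> 'v rpoly" where
  "power_product k g \<alpha> = (\<Prod>l\<in>{1..k}. g l ^ \<alpha> l)"

text \<open>
  The semiring \<open>P(G)\<close> for \<open>G = {g 1, ..., g k}\<close>. Multi-indices are functions \<open>nat \<Rightarrow> nat\<close>, of which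
  only the values on \<open>{1..k}\<close> matter.
\<close>

definition generated_semiring :: "nat \<Rightarrow> (nat \<Rightarrow> 'v rpoly) \<Rightarrow> 'v rpoly set" where
  "generated_semiring k g =
    {\<Sum>j<s. const_poly (a j) * power_product k g (\<alpha> j) | (s::nat) a \<alpha>. \<forall>j<s. a j \<ge> 0}"

text \<open>
  The set \<open>M\<^sup>t\<close> of finite sums of terms \<open>m A\<^sup>T A\<close> with \<open>m\<close> in \<open>M\<close>; the order \<open>t\<close> of the square matrices is the
  cardinality of the index type \<open>'t\<close>.
\<close>

definition weighted_matrix_squares :: "'v rpoly set \<Rightarrow> ('v rpoly ^ 't ^ 't) set" where
  "weighted_matrix_squares M =
    {\<Sum>i<r. map_matrix ((*) (m i)) (transpose (A i) ** A i) | (r::nat) m (A :: nat \<Rightarrow> 'v rpoly ^ 't ^ 't).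
      \<forall>i<r. m i \<in> M}"

definition positive_definite :: "real ^ 't ^ 't \<Rightarrow> bool" where
  "positive_definite A \<longleftrightarrow> transpose A = A \<and> (\<forall>v. v \<noteq> 0 \<longrightarrow> v \<bullet> (A *v v) > 0)"

end

theory Submission
  imports Defs
begin

text \<open>
  By Farkas' lemma, compactness of the polyhedron puts all \<open>N + X\<^sub>i\<close> and \<open>N - X\<^sub>i\<close>, for some
  \<open>N > 0\<close>, into the semiring. Rescale the \<open>g\<^sub>l\<close> to be at most 1 on the box of
  all \<open>x\<close> with \<open>\<bar>x\<^sub>i\<bar> \<le> N\<close>. For large \<open>n\<close> the penalty \<open>y (1 - y)\<^sup>2\<^sup>n\<close> is tiny on \<open>[0, 1]\<close> and very negative on \<open>y < 0\<close>, so that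
  \<open>F - (\<Sum>l. g\<^sub>l (1 - g\<^sub>l)\<^sup>2\<^sup>n) I\<close> is uniformly positive definite on the whole box; the subtracted term
  has weights \<open>g\<^sub>l\<close> and matrix squares of \<open>(1 - g\<^sub>l)\<^sup>n I\<close>. A matrix polynomial that is positive
  definite on the box has, in a Bernstein basis of high degree, coefficient matrices that are close
  to its values at grid points, hence positive semidefinite and sums of squares of constant
  matrices. The Bernstein basis is built from products of \<open>N + X\<^sub>i\<close> and \<open>N - X\<^sub>i\<close>.
\<close>

subsection \<open>Polynomials and the semiring\<close>

definition coord_poly :: "'v \<Rightarrow> 'v rpoly" where
  "coord_poly i = Poly_Mapping.single (Poly_Mapping.single i 1) 1"

text \<open>Coefficients outside the keys are 0, so \<open>p\<close>, \<open>q\<close> and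
  \<open>p + q\<close> can all be evaluated over one common support.\<close>

lemma eval_poly_superset:
  assumes "finite S" "Poly_Mapping.keys p \<subseteq> S"
  shows "eval_poly p x =
    (\<Sum>e\<in>S. Poly_Mapping.lookup p e * (\<Prod>i\<in>UNIV. (x $ i) ^ Poly_Mapping.lookup e i))"
  unfolding eval_poly_def
  by (rule sum.mono_neutral_left) (use assms in \<open>auto simp: in_keys_iff\<close>)

lemma eval_poly_0 [simp]: "eval_poly 0 x = 0"
  by (simp add: eval_poly_def)

lemma eval_poly_single:
  "eval_poly (Poly_Mapping.single e c) x = c * (\<Prod>i\<in>UNIV. (x $ i) ^ Poly_Mapping.lookup e i)"
  by (subst eval_poly_superset[of "{e}"]) auto

lemma eval_const_poly [simp]: "eval_poly (const_poly c) x = c"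
  by (simp add: const_poly_def eval_poly_single)

lemma eval_poly_1 [simp]: "eval_poly 1 x = 1"
  using eval_const_poly[of 1 x] by (simp add: const_poly_def del: eval_const_poly)

lemma eval_coord_poly [simp]: "eval_poly (coord_poly i) x = x $ i"
proof -
  have "(\<Prod>j\<in>UNIV. (x $ j) ^ Poly_Mapping.lookup (Poly_Mapping.single i (1::nat)) j) =
        (\<Prod>j\<in>UNIV. if j = i then x $ j else 1)"
    by (rule prod.cong) (auto simp: lookup_single when_def)
  then show ?thesis
    by (simp add: coord_poly_def eval_poly_single)
qed

lemma eval_poly_add [simp]: "eval_poly (p + q) x = eval_poly p x + eval_poly q x"
proof -
  let ?S = "Poly_Mapping.keys p \<union> Poly_Mapping.keys q"
  have "eval_poly r x =
      (\<Sum>e\<in>?S. Poly_Mapping.lookup r e * (\<Prod>i\<in>UNIV. (x $ i) ^ Poly_Mapping.lookup e i))"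
    if "Poly_Mapping.keys r \<subseteq> ?S" for r
    using that by (intro eval_poly_superset) auto
  then show ?thesis
    using Poly_Mapping.keys_add[of p q]
    by (simp add: lookup_add distrib_right sum.distrib)
qed

lemma eval_poly_sum [simp]: "eval_poly (sum f I) x = (\<Sum>i\<in>I. eval_poly (f i) x)"
  by (induction I rule: infinite_finite_induct) auto

lemma eval_poly_uminus [simp]: "eval_poly (- p) x = - eval_poly p x"
  using eval_poly_add[of p "- p" x] by (simp del: eval_poly_add)

lemma eval_poly_diff [simp]: "eval_poly (p - q) x = eval_poly p x - eval_poly q x"
  using eval_poly_add[of p "- q" x] by (simp del: eval_poly_add)

lemma poly_mapping_eq_sum_single:
  "p = (\<Sum>e\<in>Poly_Mapping.keys p. Poly_Mapping.single e (Poly_Mapping.lookup p e))"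
proof (rule poly_mapping_eqI)
  fix e
  show "Poly_Mapping.lookup p e = Poly_Mapping.lookup
      (\<Sum>e\<in>Poly_Mapping.keys p. Poly_Mapping.single e (Poly_Mapping.lookup p e)) e"
    by (simp add: lookup_sum lookup_single when_def in_keys_iff)
qed

lemma eval_poly_mult [simp]: "eval_poly (p * q) x = eval_poly p x * eval_poly q x"
proof -
  have single: "eval_poly (Poly_Mapping.single e a * Poly_Mapping.single f b) x =
      eval_poly (Poly_Mapping.single e a) x * eval_poly (Poly_Mapping.single f b) x" for e f a b
    by (simp add: mult_single eval_poly_single lookup_add power_add prod.distrib)
  \<comment> \<open>Index sets and coefficients are kept abstract because rewriting with
    \<open>poly_mapping_eq_sum_single\<close> itself would loop: \<open>p\<close> recurs on its
    right-hand side.\<close>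
  have "eval_poly (p' * q') x = eval_poly p' x * eval_poly q' x"
    if "p' = (\<Sum>e\<in>S. Poly_Mapping.single e (a e))" "q' = (\<Sum>f\<in>T. Poly_Mapping.single f (b f))"
    for p' q' :: "'a rpoly" and S T a b
    unfolding that by (simp add: sum_product single)
  from this[OF poly_mapping_eq_sum_single poly_mapping_eq_sum_single] show ?thesis .
qed

lemma eval_poly_power [simp]: "eval_poly (p ^ n) x = eval_poly p x ^ n"
  by (induction n) auto

lemma eval_poly_prod [simp]: "eval_poly (prod f I) x = (\<Prod>i\<in>I. eval_poly (f i) x)"
  by (induction I rule: infinite_finite_induct) auto

lemma continuous_on_eval_poly [continuous_intros]:
  "continuous_on S f \<Longrightarrow> continuous_on S (\<lambda>y. eval_poly p (f y))"
  unfolding eval_poly_def by (intro continuous_intros)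

lemma const_poly_0 [simp]: "const_poly 0 = 0"
  by (simp add: const_poly_def)

lemma const_poly_1 [simp]: "const_poly 1 = 1"
  by (simp add: const_poly_def)

lemma const_poly_add: "const_poly (a + b) = const_poly a + const_poly b"
  by (simp add: const_poly_def single_add)

lemma const_poly_uminus: "const_poly (- a) = - const_poly a"
  by (simp add: const_poly_def single_uminus)

lemma const_poly_mult: "const_poly (a * b) = const_poly a * const_poly b"
  by (simp add: const_poly_def mult_single)

lemma const_poly_prod: "const_poly (prod f I) = (\<Prod>i\<in>I. const_poly (f i))"
  by (induction I rule: infinite_finite_induct) (auto simp: const_poly_mult)

lemma const_poly_of_nat: "const_poly (of_nat n) = of_nat n"
  by (induction n) (auto simp: const_poly_add)

text \<open>By induction on the degree, every monomial arises from a constant by multiplying by one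
  variable at a time. The case \<open>coord\<close> asks for less than closure under products, so
  the rule also serves properties not known to be multiplicative.\<close>

lemma rpoly_induct [case_names const add coord]:
  fixes p :: "'v::finite rpoly"
  assumes const: "\<And>c. P (const_poly c)"
    and add: "\<And>p q. P p \<Longrightarrow> P q \<Longrightarrow> P (p + q)"
    and coord: "\<And>i p. P p \<Longrightarrow> P (coord_poly i * p)"
  shows "P p"
proof -
  have monomial: "P (Poly_Mapping.single e c)" for e :: "'v \<Rightarrow>\<^sub>0 nat" and c
  proof (induction "\<Sum>i\<in>UNIV. Poly_Mapping.lookup e i" arbitrary: e)
    case 0
    then have "e = 0"
      by (intro poly_mapping_eqI) simp
    then show ?case
      using const[of c] by (simp add: const_poly_def)
  next
    case (Suc n)
    then obtain i where i: "Poly_Mapping.lookup e i > 0"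
      by (metis gr0I nat.distinct(1) sum.neutral)
    define e' where "e' = e - Poly_Mapping.single i 1"
    have e: "e = Poly_Mapping.single i 1 + e'"
      using i by (intro poly_mapping_eqI) (auto simp: e'_def lookup_add lookup_minus lookup_single when_def)
    have "n = (\<Sum>i\<in>UNIV. Poly_Mapping.lookup e' i)"
      using Suc.hyps(2) unfolding e
      by (simp add: lookup_add sum.distrib lookup_single when_def)
    from Suc.hyps(1)[OF this] have "P (coord_poly i * Poly_Mapping.single e' c)"
      by (rule coord)
    then show ?case
      by (simp add: coord_poly_def mult_single e)
  qed
  have "P (\<Sum>e\<in>S. Poly_Mapping.single e (Poly_Mapping.lookup p e))" if "finite S" for S
    using that const[of 0] by induction (auto intro: add monomial)
  then show ?thesis
    by (subst poly_mapping_eq_sum_single) simp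
qed

text \<open>Coefficients are compared: an exponent vector of degree at most 1 is zero or a unit
  vector. The result turns linear polynomials into the vectors that Farkas' lemma works
  with.\<close>

lemma affine_eq_coord_sum:
  fixes p :: "'v::finite rpoly"
  assumes "total_degree p \<le> 1"
  obtains a b where "p = const_poly b + (\<Sum>i\<in>UNIV. const_poly (a $ i) * coord_poly i)"
proof
  let ?b = "Poly_Mapping.lookup p 0"
  let ?a = "(\<chi> i. Poly_Mapping.lookup p (Poly_Mapping.single i 1)) :: real ^ 'v"
  show "p = const_poly ?b + (\<Sum>i\<in>UNIV. const_poly (?a $ i) * coord_poly i)"
  proof (rule poly_mapping_eqI)
    fix e :: "'v \<Rightarrow>\<^sub>0 nat"
    have rhs: "Poly_Mapping.lookup
        (const_poly ?b + (\<Sum>i\<in>UNIV. const_poly (?a $ i) * coord_poly i)) e =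
      (?b when 0 = e) + (\<Sum>i\<in>UNIV. (?a $ i when Poly_Mapping.single i 1 = e))"
      by (simp add: lookup_add lookup_sum const_poly_def coord_poly_def mult_single lookup_single)
    consider "e = 0" | j where "e = Poly_Mapping.single j 1"
      | "e \<noteq> 0" "\<And>j. e \<noteq> Poly_Mapping.single j 1" by blast
    then show "Poly_Mapping.lookup p e = Poly_Mapping.lookup
        (const_poly ?b + (\<Sum>i\<in>UNIV. const_poly (?a $ i) * coord_poly i)) e"
    proof cases
      case 1
      have "Poly_Mapping.single i (1::nat) \<noteq> 0" for i :: 'v
        by (metis lookup_single_eq lookup_zero zero_neq_one)
      then show ?thesis
        unfolding rhs using 1 by (simp add: when_def)
    next
      case 2
      have *: "Poly_Mapping.single i (1::nat) = Poly_Mapping.single j 1 \<longleftrightarrow> i = j" for i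
        by (metis lookup_single_eq lookup_single_not_eq zero_neq_one)
      have "Poly_Mapping.single j (1::nat) \<noteq> 0"
        by (metis lookup_single_eq lookup_zero zero_neq_one)
      then show ?thesis
        unfolding rhs using 2 by (auto simp add: when_def * simp del: One_nat_def)
    next
      case 3
      have "Poly_Mapping.lookup p e = 0"
      proof (rule ccontr)
        assume "Poly_Mapping.lookup p e \<noteq> 0"
        then have "(\<Sum>i\<in>UNIV. Poly_Mapping.lookup e i) \<le> total_degree p"
          unfolding total_degree_def by (intro Max_ge) (auto simp: in_keys_iff)
        with assms have deg: "(\<Sum>i\<in>UNIV. Poly_Mapping.lookup e i) \<le> 1"
          by simp
        from \<open>e \<noteq> 0\<close> obtain j where j: "Poly_Mapping.lookup e j \<noteq> 0"
          by (metis lookup_zero poly_mapping_eqI)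
        have "(\<Sum>i\<in>UNIV. Poly_Mapping.lookup e i) =
            Poly_Mapping.lookup e j + (\<Sum>i\<in>UNIV - {j}. Poly_Mapping.lookup e i)"
          by (simp add: sum.remove)
        with deg j have "Poly_Mapping.lookup e j = 1" "(\<Sum>i\<in>UNIV - {j}. Poly_Mapping.lookup e i) = 0"
          by linarith+
        then have "e = Poly_Mapping.single j 1"
          by (intro poly_mapping_eqI) (auto simp: lookup_single when_def)
        with 3 show False by blast
      qed
      then show ?thesis
        unfolding rhs using 3 by (simp add: when_def eq_commute[of _ e])
    qed
  qed
qed

section \<open>Closure properties of the semiring generated by \<open>g\<close>\<close>

lemma generated_semiringE:
  assumes "p \<in> generated_semiring k g"
  obtains s :: nat and a \<alpha> where "p = (\<Sum>j<s. const_poly (a j) * power_product k g (\<alpha> j))"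
    "\<forall>j<s. a j \<ge> 0"
  using assms unfolding generated_semiring_def mem_Collect_eq by blast

lemma generated_semiringI:
  fixes s :: nat
  assumes "p = (\<Sum>j<s. const_poly (a j) * power_product k g (\<alpha> j))" "\<And>j. j < s \<Longrightarrow> a j \<ge> 0"
  shows "p \<in> generated_semiring k g"
  using assms unfolding generated_semiring_def mem_Collect_eq by blast

text \<open>Appending a single term by updating the sequences at \<open>s\<close> reduces closure
  under addition to an induction, without splicing two index ranges.\<close>

lemma generated_semiring_add_term:
  assumes "p \<in> generated_semiring k g" "a \<ge> 0"
  shows "p + const_poly a * power_product k g \<alpha> \<in> generated_semiring k g"
proof -
  obtain s :: nat and b \<beta> where p: "p = (\<Sum>j<s. const_poly (b j) * power_product k g (\<beta> j))"
    and b: "\<forall>j<s. b j \<ge> 0"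
    using assms(1) by (rule generated_semiringE)
  have "p + const_poly a * power_product k g \<alpha> =
      (\<Sum>j<Suc s. const_poly ((b(s := a)) j) * power_product k g ((\<beta>(s := \<alpha>)) j))"
    by (simp add: p)
  moreover have "(b(s := a)) j \<ge> 0" if "j < Suc s" for j
    using that b assms(2) by (auto simp: less_Suc_eq)
  ultimately show ?thesis
    by (rule generated_semiringI)
qed

lemma generated_semiring_0: "0 \<in> generated_semiring k g"
  by (rule generated_semiringI[where s = 0]) auto

lemma generated_semiring_term:
  "a \<ge> 0 \<Longrightarrow> const_poly a * power_product k g \<alpha> \<in> generated_semiring k g"
  using generated_semiring_add_term[OF generated_semiring_0, of a k g \<alpha>] by simp

lemma generated_semiring_add:
  assumes "p \<in> generated_semiring k g" "q \<in> generated_semiring k g"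
  shows "p + q \<in> generated_semiring k g"
proof -
  obtain s :: nat and b \<beta> where q: "q = (\<Sum>j<s. const_poly (b j) * power_product k g (\<beta> j))"
    and b: "\<forall>j<s. b j \<ge> 0"
    using assms(2) by (rule generated_semiringE)
  have "p + (\<Sum>j<s'. const_poly (b j) * power_product k g (\<beta> j)) \<in> generated_semiring k g"
    if "s' \<le> s" for s'
    using that
  proof (induction s')
    case 0
    then show ?case using assms by simp
  next
    case (Suc s')
    then have "p + (\<Sum>j<s'. const_poly (b j) * power_product k g (\<beta> j)) +
        const_poly (b s') * power_product k g (\<beta> s') \<in> generated_semiring k g"
      using b by (intro generated_semiring_add_term) auto
    then show ?case by (simp add: add.assoc)
  qed
  then show ?thesis using q by blast
qed

lemma generated_semiring_sum:
  "(\<And>i. i \<in> I \<Longrightarrow> f i \<in> generated_semiring k g) \<Longrightarrow> sum f I \<in> generated_semiring k g"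
  by (induction I rule: infinite_finite_induct)
    (auto intro: generated_semiring_add generated_semiring_0)

lemma power_product_mult:
  "power_product k g \<alpha> * power_product k g \<beta> = power_product k g (\<lambda>i. \<alpha> i + \<beta> i)"
  by (simp add: power_product_def power_add prod.distrib)

lemma generated_semiring_mult:
  assumes "p \<in> generated_semiring k g" "q \<in> generated_semiring k g"
  shows "p * q \<in> generated_semiring k g"
proof -
  obtain s :: nat and b \<beta> where q: "q = (\<Sum>j<s. const_poly (b j) * power_product k g (\<beta> j))"
    and b: "\<forall>j<s. b j \<ge> 0"
    using assms(2) by (rule generated_semiringE)
  obtain r :: nat and a \<alpha> where p: "p = (\<Sum>j<r. const_poly (a j) * power_product k g (\<alpha> j))"
    and a: "\<forall>j<r. a j \<ge> 0"
    using assms(1) by (rule generated_semiringE)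
  have "const_poly (a i) * power_product k g (\<alpha> i) * (const_poly (b j) * power_product k g (\<beta> j))
      \<in> generated_semiring k g" if "i < r" "j < s" for i j
  proof -
    have "const_poly (a i) * power_product k g (\<alpha> i) * (const_poly (b j) * power_product k g (\<beta> j)) =
       const_poly (a i * b j) * power_product k g (\<lambda>l. \<alpha> i l + \<beta> j l)"
      by (simp add: const_poly_mult flip: power_product_mult)
    then show ?thesis
      using that a b by (simp add: generated_semiring_term)
  qed
  then show ?thesis
    unfolding p q sum_product by (intro generated_semiring_sum) auto
qed

lemma generated_semiring_const: "c \<ge> 0 \<Longrightarrow> const_poly c \<in> generated_semiring k g"
  using generated_semiring_term[of c k g "\<lambda>_. 0"] by (simp add: power_product_def)

lemma generated_semiring_1: "1 \<in> generated_semiring k g"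
  using generated_semiring_const[of 1] by simp

lemma generated_semiring_of_nat: "of_nat n \<in> generated_semiring k g"
  using generated_semiring_const[of "of_nat n"] by (simp add: const_poly_of_nat)

lemma generated_semiring_generator:
  assumes "l \<in> {1..k}" shows "g l \<in> generated_semiring k g"
proof -
  have "power_product k g (\<lambda>i. if i = l then 1 else 0) = (\<Prod>i\<in>{1..k}. if i = l then g i else 1)"
    unfolding power_product_def by (rule prod.cong) auto
  also have "\<dots> = g l"
    using assms by simp
  finally show ?thesis
    using generated_semiring_term[of 1 k g "\<lambda>i. if i = l then 1 else 0"] by simp
qed

lemma generated_semiring_prod:
  "(\<And>i. i \<in> I \<Longrightarrow> f i \<in> generated_semiring k g) \<Longrightarrow> prod f I \<in> generated_semiring k g"
  by (induction I rule: infinite_finite_induct)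
    (auto intro: generated_semiring_mult generated_semiring_1)

lemma generated_semiring_power:
  "p \<in> generated_semiring k g \<Longrightarrow> p ^ n \<in> generated_semiring k g"
  by (induction n) (auto intro: generated_semiring_mult generated_semiring_1)

section \<open>Closure properties of sums of weighted matrix squares\<close>

lemma weighted_matrix_squaresE:
  fixes M :: "'v rpoly ^ 't::finite ^ 't"
  assumes "M \<in> weighted_matrix_squares S"
  obtains r :: nat and m and A :: "nat \<Rightarrow> 'v rpoly ^ 't ^ 't"
  where "M = (\<Sum>i<r. map_matrix ((*) (m i)) (transpose (A i) ** A i))" "\<forall>i<r. m i \<in> S"
  using assms unfolding weighted_matrix_squares_def mem_Collect_eq by blast

lemma weighted_matrix_squaresI:
  fixes A :: "nat \<Rightarrow> 'v rpoly ^ 't::finite ^ 't"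
  assumes "M = (\<Sum>i<r. map_matrix ((*) (m i)) (transpose (A i) ** A i))" "\<And>i. i < r \<Longrightarrow> m i \<in> S"
  shows "M \<in> weighted_matrix_squares S"
  using assms unfolding weighted_matrix_squares_def mem_Collect_eq by blast

lemma weighted_matrix_squares_add_term:
  fixes A :: "'v rpoly ^ 't::finite ^ 't"
  assumes "M \<in> weighted_matrix_squares S" "p \<in> S"
  shows "M + map_matrix ((*) p) (transpose A ** A) \<in> weighted_matrix_squares S"
proof -
  obtain r :: nat and m and B :: "nat \<Rightarrow> 'v rpoly ^ 't ^ 't"
    where M: "M = (\<Sum>i<r. map_matrix ((*) (m i)) (transpose (B i) ** B i))"
    and m: "\<forall>i<r. m i \<in> S"
    using assms(1) by (rule weighted_matrix_squaresE)
  have "M + map_matrix ((*) p) (transpose A ** A) =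
      (\<Sum>i<Suc r. map_matrix ((*) ((m(r := p)) i)) (transpose ((B(r := A)) i) ** (B(r := A)) i))"
    by (simp add: M)
  moreover have "(m(r := p)) i \<in> S" if "i < Suc r" for i
    using that m assms(2) by (auto simp: less_Suc_eq)
  ultimately show ?thesis
    by (rule weighted_matrix_squaresI)
qed

lemma weighted_matrix_squares_0: "0 \<in> weighted_matrix_squares S"
  by (rule weighted_matrix_squaresI[where r = 0]) auto

lemma weighted_matrix_squares_term:
  fixes A :: "'v rpoly ^ 't::finite ^ 't"
  shows "p \<in> S \<Longrightarrow> map_matrix ((*) p) (transpose A ** A) \<in> weighted_matrix_squares S"
  using weighted_matrix_squares_add_term[OF weighted_matrix_squares_0, of p S A] by simp

lemma weighted_matrix_squares_add:
  fixes M :: "'v rpoly ^ 't::finite ^ 't"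
  assumes "M \<in> weighted_matrix_squares S" "N \<in> weighted_matrix_squares S"
  shows "M + N \<in> weighted_matrix_squares S"
proof -
  obtain r :: nat and m and B :: "nat \<Rightarrow> 'v rpoly ^ 't ^ 't"
    where N: "N = (\<Sum>i<r. map_matrix ((*) (m i)) (transpose (B i) ** B i))"
    and m: "\<forall>i<r. m i \<in> S"
    using assms(2) by (rule weighted_matrix_squaresE)
  have "M + (\<Sum>i<r'. map_matrix ((*) (m i)) (transpose (B i) ** B i)) \<in> weighted_matrix_squares S"
    if "r' \<le> r" for r'
    using that
  proof (induction r')
    case 0
    then show ?case using assms by simp
  next
    case (Suc r')
    then have "M + (\<Sum>i<r'. map_matrix ((*) (m i)) (transpose (B i) ** B i)) +
        map_matrix ((*) (m r')) (transpose (B r') ** B r') \<in> weighted_matrix_squares S"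
      using m by (intro weighted_matrix_squares_add_term) auto
    then show ?case by (simp add: add.assoc)
  qed
  then show ?thesis using N by blast
qed

lemma weighted_matrix_squares_sum:
  "(\<And>i. i \<in> I \<Longrightarrow> f i \<in> weighted_matrix_squares S) \<Longrightarrow> sum f I \<in> weighted_matrix_squares S"
  by (induction I rule: infinite_finite_induct)
    (auto intro: weighted_matrix_squares_add weighted_matrix_squares_0)

text \<open>The factor \<open>p\<close> is absorbed into the weights \<open>m i\<close>.\<close>

lemma weighted_matrix_squares_smult:
  fixes M :: "'v rpoly ^ 't::finite ^ 't"
  assumes S: "\<And>p q. p \<in> S \<Longrightarrow> q \<in> S \<Longrightarrow> p * q \<in> S"
    and "p \<in> S" "M \<in> weighted_matrix_squares S"
  shows "map_matrix ((*) p) M \<in> weighted_matrix_squares S"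
proof -
  obtain r :: nat and m and B :: "nat \<Rightarrow> 'v rpoly ^ 't ^ 't"
    where M: "M = (\<Sum>i<r. map_matrix ((*) (m i)) (transpose (B i) ** B i))"
    and m: "\<forall>i<r. m i \<in> S"
    using assms(3) by (rule weighted_matrix_squaresE)
  have "map_matrix ((*) p) M = (\<Sum>i<r. map_matrix ((*) (p * m i)) (transpose (B i) ** B i))"
    by (simp add: M vec_eq_iff sum_distrib_left mult.assoc)
  then show ?thesis
    using m S \<open>p \<in> S\<close> by (auto intro!: weighted_matrix_squares_sum weighted_matrix_squares_term)
qed

subsection \<open>Farkas' lemma\<close>

text \<open>A finitely generated cone is closed, so a pair \<open>(c, d)\<close> outside it is
  separated by some \<open>w = (y, s)\<close> that is non-negative on the cone; the generator
  \<open>(0, 1)\<close>, which stands for constant slack, yields \<open>s \<ge> 0\<close>. If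
  \<open>s > 0\<close>, the point \<open>y / s\<close> is feasible and violates the target
  inequality. If \<open>s = 0\<close>, \<open>y\<close> is a recession direction, and moving along
  it from the feasible point \<open>x0\<close> eventually violates that inequality.\<close>

lemma farkas_affine:
  fixes a :: "'i \<Rightarrow> 'a::euclidean_space" and b :: "'i \<Rightarrow> real"
  assumes "finite I" and x0: "\<And>l. l \<in> I \<Longrightarrow> a l \<bullet> x0 + b l \<ge> 0"
    and nonneg: "\<And>x. (\<And>l. l \<in> I \<Longrightarrow> a l \<bullet> x + b l \<ge> 0) \<Longrightarrow> c \<bullet> x + d \<ge> 0"
  shows "(c, d) \<in> convex_cone hull (insert (0, 1) ((\<lambda>l. (a l, b l)) ` I))"
    (is "_ \<in> convex_cone hull ?G")
proof (rule ccontr)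
  assume notin: "(c, d) \<notin> convex_cone hull ?G"
  have "closed (convex_cone hull ?G)" "convex (convex_cone hull ?G)"
    using \<open>finite I\<close> by (auto intro: closed_convex_cone_hull convex_convex_cone_hull)
  from separating_hyperplane_closed_point[OF this(2,1) notin]
  obtain w \<beta> where w: "w \<bullet> (c, d) < \<beta>" "\<And>z. z \<in> convex_cone hull ?G \<Longrightarrow> w \<bullet> z > \<beta>"
    by blast
  obtain y s where ys: "w = (y, s)" by (cases w)
  have "\<beta> < 0"
    using w(2)[OF convex_cone_hull_contains_0] by simp
  \<comment> \<open>If \<open>w\<close> were negative at \<open>z\<close>, the positive multiple of
    \<open>z\<close> on which \<open>w\<close> takes exactly the value \<open>\<beta>\<close> would
    still lie in the cone, against strict separation.\<close>
  have pos: "w \<bullet> z \<ge> 0" if "z \<in> convex_cone hull ?G" for z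
  proof (rule ccontr)
    assume neg: "\<not> w \<bullet> z \<ge> 0"
    then have "(\<beta> / (w \<bullet> z)) *\<^sub>R z \<in> convex_cone hull ?G"
      using \<open>\<beta> < 0\<close> that by (intro convex_cone_hull_mul) (auto intro: divide_nonpos_neg)
    from w(2)[OF this] neg show False by simp
  qed
  have gen: "y \<bullet> a l + s * b l \<ge> 0" if "l \<in> I" for l
    using pos[OF hull_inc, of "(a l, b l)"] that by (simp add: ys)
  have "s \<ge> 0"
    using pos[OF hull_inc, of "(0, 1)"] by (simp add: ys)
  have neg: "y \<bullet> c + s * d < 0"
    using w(1) \<open>\<beta> < 0\<close> by (simp add: ys)
  show False
  proof (cases "s = 0")
    case True
    \<comment> \<open>This length makes the change \<open>r * (y \<bullet> c)\<close> equal to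
      \<open>- (\<bar>c \<bullet> x0 + d\<bar> + 1)\<close>, so the target drops to at most
      -1.\<close>
    define r where "r = (\<bar>c \<bullet> x0 + d\<bar> + 1) / - (y \<bullet> c)"
    have "y \<bullet> c < 0" using neg True by simp
    then have "r \<ge> 0" by (auto simp: r_def intro!: divide_nonneg_neg)
    have "a l \<bullet> (x0 + r *\<^sub>R y) + b l \<ge> 0" if "l \<in> I" for l
    proof -
      have "r * (y \<bullet> a l) \<ge> 0"
        using gen[OF that] True \<open>r \<ge> 0\<close> by simp
      moreover have "a l \<bullet> (x0 + r *\<^sub>R y) + b l = (a l \<bullet> x0 + b l) + r * (y \<bullet> a l)"
        by (simp add: inner_add_right inner_commute)
      ultimately show ?thesis
        using x0[OF that] by linarith
    qed
    then have "c \<bullet> (x0 + r *\<^sub>R y) + d \<ge> 0" by (rule nonneg)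
    moreover have "r * (y \<bullet> c) = - (\<bar>c \<bullet> x0 + d\<bar> + 1)"
      using \<open>y \<bullet> c < 0\<close> by (simp add: r_def)
    ultimately show False
      by (simp add: inner_add_right inner_commute)
  next
    case False
    with \<open>s \<ge> 0\<close> have "s > 0" by simp
    have "a l \<bullet> (y /\<^sub>R s) + b l = (y \<bullet> a l + s * b l) / s" for l
      using \<open>s > 0\<close> by (simp add: field_simps inner_commute)
    then have "a l \<bullet> (y /\<^sub>R s) + b l \<ge> 0" if "l \<in> I" for l
      using gen[OF that] \<open>s > 0\<close> by simp
    then have "c \<bullet> (y /\<^sub>R s) + d \<ge> 0" by (rule nonneg)
    moreover have "c \<bullet> (y /\<^sub>R s) + d = (y \<bullet> c + s * d) / s"
      using \<open>s > 0\<close> by (simp add: field_simps inner_commute)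
    ultimately show False
      using neg \<open>s > 0\<close> by (simp add: divide_less_0_iff flip: not_less)
  qed
qed

section \<open>Linear polynomials that are non-negative on the polyhedron\<close>

definition affine_poly :: "real ^ 'v \<Rightarrow> real \<Rightarrow> 'v::finite rpoly" where
  "affine_poly a b = const_poly b + (\<Sum>i\<in>UNIV. const_poly (a $ i) * coord_poly i)"

lemma eval_affine_poly: "eval_poly (affine_poly a b) x = a \<bullet> x + b"
  by (simp add: affine_poly_def inner_vec_def)

lemma affine_poly_0: "affine_poly 0 0 = 0"
  by (simp add: affine_poly_def)

lemma affine_poly_add: "affine_poly (a + a') (b + b') = affine_poly a b + affine_poly a' b'"
  by (simp add: affine_poly_def const_poly_add distrib_right sum.distrib)

lemma affine_poly_scaleR: "affine_poly (c *\<^sub>R a) (c * b) = const_poly c * affine_poly a b"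
  by (simp add: affine_poly_def const_poly_mult distrib_left sum_distrib_left mult.assoc)

lemma affine_poly_axis: "affine_poly (axis i c) b = const_poly b + const_poly c * coord_poly i"
proof -
  have "(\<Sum>j\<in>UNIV. const_poly (axis i c $ j) * coord_poly j) =
      (\<Sum>j\<in>UNIV. if j = i then const_poly c * coord_poly j else 0)"
    by (rule sum.cong) (auto simp: axis_def)
  then show ?thesis by (simp add: affine_poly_def)
qed

text \<open>Farkas' lemma places \<open>(c, d)\<close> in the cone spanned by \<open>(0, 1)\<close>
  and the coefficient pairs of the linear generators. The pairs whose polynomial lies in the
  semiring form a convex cone containing all of these, hence the whole hull.\<close>

lemma affine_nonneg_in_generated_semiring:
  fixes g :: "nat \<Rightarrow> 'v::finite rpoly"
  assumes "m \<le> k" and deg: "\<And>l. l \<in> {1..m} \<Longrightarrow> total_degree (g l) \<le> 1"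
    and ne: "nonneg_set (g ` {1..m}) \<noteq> {}"
    and nonneg: "\<And>x. x \<in> nonneg_set (g ` {1..m}) \<Longrightarrow> c \<bullet> x + d \<ge> 0"
  shows "affine_poly c d \<in> generated_semiring k g"
proof -
  have "\<exists>a b. g l = affine_poly a b" if "l \<in> {1..m}" for l
    using affine_eq_coord_sum[OF deg[OF that]] unfolding affine_poly_def by metis
  then obtain a b where g: "\<And>l. l \<in> {1..m} \<Longrightarrow> g l = affine_poly (a l) (b l)"
    by metis
  have K: "x \<in> nonneg_set (g ` {1..m}) \<longleftrightarrow> (\<forall>l\<in>{1..m}. a l \<bullet> x + b l \<ge> 0)" for x
    using g by (auto simp: nonneg_set_def eval_affine_poly)
  obtain x0 where x0: "x0 \<in> nonneg_set (g ` {1..m})"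
    using ne by blast
  have cone: "(c, d) \<in> convex_cone hull (insert (0, 1) ((\<lambda>l. (a l, b l)) ` {1..m}))"
    by (rule farkas_affine[of _ _ x0]) (use x0 nonneg K in auto)
  let ?T = "{z. affine_poly (fst z) (snd z) \<in> generated_semiring k g}"
  have "convex_cone ?T"
    unfolding convex_cone_iff
    by (auto simp: affine_poly_add affine_poly_scaleR affine_poly_0 generated_semiring_0
        intro: generated_semiring_add generated_semiring_mult generated_semiring_const)
  moreover have "affine_poly (a l) (b l) \<in> generated_semiring k g" if "l \<in> {1..m}" for l
    using generated_semiring_generator[of l k g] that g[OF that] \<open>m \<le> k\<close> by simp
  moreover have "affine_poly 0 1 \<in> generated_semiring k g"
    using generated_semiring_1[of k g] by (simp add: affine_poly_def)
  ultimately have "convex_cone hull (insert (0, 1) ((\<lambda>l. (a l, b l)) ` {1..m})) \<subseteq> ?T"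
    by (intro hull_minimal) auto
  with cone show ?thesis by auto
qed

text \<open>The polyhedron lies in a ball of radius \<open>N\<close>, so
  \<open>N + s * x $ i\<close> is non-negative on it for both signs \<open>s\<close>, and the
  previous lemma applies.\<close>

lemma coordinate_bounds_in_generated_semiring:
  fixes g :: "nat \<Rightarrow> 'v::finite rpoly"
  assumes "m \<le> k" and deg: "\<And>l. l \<in> {1..m} \<Longrightarrow> total_degree (g l) \<le> 1"
    and ne: "nonneg_set (g ` {1..m}) \<noteq> {}"
    and "compact (nonneg_set (g ` {1..m}))"
  obtains N where "N > 0" "\<And>i. const_poly N + coord_poly i \<in> generated_semiring k g"
    "\<And>i. const_poly N - coord_poly i \<in> generated_semiring k g"
proof -
  obtain N where N: "N > 0" "\<And>x. x \<in> nonneg_set (g ` {1..m}) \<Longrightarrow> norm x \<le> N"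
    using compact_imp_bounded[OF assms(4)] by (auto simp: bounded_pos)
  have x: "\<bar>x $ i\<bar> \<le> N" if "x \<in> nonneg_set (g ` {1..m})" for x i
    using N(2)[OF that] component_le_norm_cart[of x i] by simp
  have "affine_poly (axis i s) N \<in> generated_semiring k g" if "\<bar>s\<bar> = 1" for i s
  proof (rule affine_nonneg_in_generated_semiring[OF assms(1-3)])
    fix x assume "x \<in> nonneg_set (g ` {1..m})"
    then have "\<bar>s * x $ i\<bar> \<le> N"
      using x[of x i] that by (simp add: abs_mult)
    then show "axis i s \<bullet> x + N \<ge> 0"
      by (simp add: inner_axis')
  qed
  from this[of 1] this[of "-1"] show ?thesis
    using N(1) by (intro that[of N]) (auto simp: affine_poly_axis const_poly_uminus)
qed

subsection \<open>Bernstein expansions\<close>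

text \<open>Both binomials satisfy the same recursion, whose factor \<open>1 / Suc b\<close>
  cancels. With the difference \<open>n - b\<close> taken in the reals, the recursion also holds for
  \<open>n < b\<close>, where the binomials vanish.\<close>

lemma binomial_ratio_Suc:
  "real (j choose Suc b) / real (d choose Suc b) =
    real (j choose b) / real (d choose b) * ((real j - real b) / (real d - real b))"
proof -
  have "real (n choose Suc b) = real (n choose b) * (real n - real b) / real (Suc b)" for n
  proof -
    have "Suc b * (n choose Suc b) = (n - b) * (n choose b)"
      by (metis binomial_absorb_comp binomial_absorption mult.commute)
    then have "real (Suc b) * real (n choose Suc b) = real (n - b) * real (n choose b)"
      by (metis of_nat_mult)
    moreover have "real (n - b) * real (n choose b) = (real n - real b) * real (n choose b)"
      by (cases "b \<le> n") (simp_all add: of_nat_diff)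
    ultimately show ?thesis
      by (simp add: field_simps del: of_nat_Suc)
  qed
  then show ?thesis
    by (simp del: of_nat_Suc)
qed

text \<open>The ratio is the product of the \<open>(j - i) / (d - i)\<close> over
  \<open>i < b\<close>, and each factor differs from \<open>j / d\<close> by at most
  \<open>i / (d - i)\<close>. All quantities compared for \<open>\<le>\<close> stay in the unit
  interval, so the errors add up, and \<open>b + b\<^sup>2 \<le> (b + 1)\<^sup>2\<close> closes the
  induction.\<close>

lemma binomial_ratio_approx:
  assumes "j \<le> d" "b < d"
  shows "\<bar>real (j choose b) / real (d choose b) - (real j / real d) ^ b\<bar> \<le>
    (real b)\<^sup>2 / (real d - real b)"
  using assms(2)
proof (induction b)
  case 0
  then show ?case by simp
next
  case (Suc b)
  define q x where "q = real (j choose b) / real (d choose b)" and "x = real j / real d"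
  have "real (j choose b) \<le> real (d choose b)"
    using assms(1) by (simp add: binomial_right_mono)
  then have q: "0 \<le> q" "q \<le> 1"
    by (auto simp: q_def divide_le_eq_1)
  have x: "0 \<le> x" "x \<le> 1"
    using assms(1) by (auto simp: x_def divide_le_eq_1)
  have d: "real d - real b > 1"
    using Suc.prems by linarith
  have IH: "\<bar>q - x ^ b\<bar> \<le> (real b)\<^sup>2 / (real d - real b)"
    using Suc by (simp add: q_def x_def)
  have "(real j - real b) / (real d - real b) - x = - (real b * (1 - x)) / (real d - real b)"
    using d by (simp add: x_def field_simps)
  then have "\<bar>(real j - real b) / (real d - real b) - x\<bar> = real b * (1 - x) / (real d - real b)"
    using d x by (simp add: abs_mult)
  also have "\<dots> \<le> real b / (real d - real b)"
    using d x by (intro divide_right_mono) (auto intro: mult_left_le)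
  finally have step: "\<bar>(real j - real b) / (real d - real b) - x\<bar> \<le> real b / (real d - real b)" .
  have "q * ((real j - real b) / (real d - real b)) - x ^ Suc b =
      q * ((real j - real b) / (real d - real b) - x) + (q - x ^ b) * x"
    by (simp add: algebra_simps)
  also have "\<bar>\<dots>\<bar> \<le> \<bar>q * ((real j - real b) / (real d - real b) - x)\<bar> + \<bar>(q - x ^ b) * x\<bar>"
    by (rule abs_triangle_ineq)
  also have "\<dots> \<le> \<bar>(real j - real b) / (real d - real b) - x\<bar> + \<bar>q - x ^ b\<bar>"
    using q x by (intro add_mono) (auto simp: abs_mult intro: mult_left_le mult_left_le_one_le)
  also have "\<dots> \<le> real b / (real d - real b) + (real b)\<^sup>2 / (real d - real b)"
    using step IH by simp
  also have "\<dots> = (real b + (real b)\<^sup>2) / (real d - real b)"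
    by (simp add: add_divide_distrib)
  also have "\<dots> \<le> (real (Suc b))\<^sup>2 / (real d - real (Suc b))"
    using d by (intro frac_le) (auto simp: power2_eq_square algebra_simps)
  finally show ?case
    by (simp only: binomial_ratio_Suc q_def x_def)
qed

lemma binomial_ratio_tendsto:
  "((\<lambda>d. (real b)\<^sup>2 / (real d - real b)) \<longlongrightarrow> 0) sequentially"
  by (intro tendsto_divide_0[OF tendsto_const] filterlim_at_top_imp_at_infinity
      filterlim_tendsto_add_at_top[of "\<lambda>_. - real b", simplified] )
    (auto intro: filterlim_real_sequentially)

text \<open>Multiply \<open>y ^ b\<close> by \<open>(y + (1 - y)) ^ (d - b) = 1\<close>, expand
  binomially and shift the index by \<open>b\<close>.\<close>

lemma power_eq_bernstein_sum:
  fixes y :: "'a::comm_ring_1"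
  assumes "b \<le> d"
  shows "y ^ b = (\<Sum>j\<le>d. if b \<le> j then of_nat ((d - b) choose (j - b)) * y ^ j * (1 - y) ^ (d - j) else 0)"
proof -
  have "y ^ b = y ^ b * (y + (1 - y)) ^ (d - b)"
    by simp
  also have "\<dots> = (\<Sum>i\<le>d - b. of_nat ((d - b) choose i) * y ^ (i + b) * (1 - y) ^ (d - b - i))"
    unfolding binomial_ring sum_distrib_left by (simp add: power_add algebra_simps)
  also have "\<dots> = (\<Sum>j\<in>{b..d}. of_nat ((d - b) choose (j - b)) * y ^ j * (1 - y) ^ (d - j))"
    by (rule sum.reindex_bij_witness[of _ "\<lambda>j. j - b" "\<lambda>i. i + b"])
      (use assms in \<open>auto simp: add.commute\<close>)
  also have "\<dots> = (\<Sum>j\<le>d. if b \<le> j then of_nat ((d - b) choose (j - b)) * y ^ j * (1 - y) ^ (d - j) else 0)"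
    by (rule sum.mono_neutral_cong_left) auto
  finally show ?thesis .
qed

text \<open>The tensor-product Bernstein polynomial of degree \<open>d\<close> in each variable,
  with \<open>u i\<close> substituted for the variables so that it can be transported from the unit
  cube to another box.\<close>

definition bernstein_poly :: "('v \<Rightarrow> 'v::finite rpoly) \<Rightarrow> nat \<Rightarrow> ('v \<Rightarrow> nat) \<Rightarrow> 'v rpoly" where
  "bernstein_poly u d j = (\<Prod>i\<in>UNIV. of_nat (d choose j i) * u i ^ j i * (1 - u i) ^ (d - j i))"

definition multi_indices :: "nat \<Rightarrow> ('v::finite \<Rightarrow> nat) set" where
  "multi_indices d = PiE UNIV (\<lambda>_. {..d})"

lemma finite_multi_indices [simp]: "finite (multi_indices d)"
  by (simp add: multi_indices_def finite_PiE)

lemma multi_indices_le: "j \<in> multi_indices d \<Longrightarrow> j i \<le> d"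
  by (auto simp: multi_indices_def PiE_def)

text \<open>The identity \<open>(d choose j) * (j choose b) = (d choose b) * ((d - b) choose (j -
  b))\<close> isolates the Bernstein factor \<open>d choose j\<close>. Terms with
  \<open>j < b\<close> have coefficient 0.\<close>

lemma power_eq_sum_const_poly:
  fixes y :: "'v rpoly"
  assumes "b \<le> d"
  shows "y ^ b = (\<Sum>j\<le>d. const_poly (real (j choose b) / real (d choose b)) *
    (of_nat (d choose j) * y ^ j * (1 - y) ^ (d - j)))"
  unfolding power_eq_bernstein_sum[OF assms]
proof (rule sum.cong)
  fix j assume "j \<in> {..d}"
  then have "j \<le> d" by simp
  show "(if b \<le> j then of_nat ((d - b) choose (j - b)) * y ^ j * (1 - y) ^ (d - j) else 0) =
    const_poly (real (j choose b) / real (d choose b)) *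
    (of_nat (d choose j) * y ^ j * (1 - y) ^ (d - j))"
  proof (cases "b \<le> j")
    case True
    have "real (d choose j) * real (j choose b) = real (d choose b) * real ((d - b) choose (j - b))"
      using choose_mult[OF True \<open>j \<le> d\<close>] by (metis of_nat_mult)
    moreover have "real (d choose b) > 0"
      using assms by simp
    ultimately have "real (j choose b) / real (d choose b) * real (d choose j) =
        real ((d - b) choose (j - b))"
      by (simp add: field_simps)
    then have "const_poly (real (j choose b) / real (d choose b)) * of_nat (d choose j) =
        (of_nat ((d - b) choose (j - b)) :: 'v rpoly)"
      by (metis const_poly_mult const_poly_of_nat)
    then show ?thesis
      using True by (simp flip: mult.assoc)
  next
    case False
    then show ?thesis by (simp add: binomial_eq_0)
  qed
qed simp

lemma power_prod_eq_bernstein_sum: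
  fixes u :: "'v::finite \<Rightarrow> 'v rpoly"
  assumes "\<And>i. \<beta> i \<le> d"
  shows "(\<Prod>i\<in>UNIV. u i ^ \<beta> i) = (\<Sum>j\<in>multi_indices d.
    const_poly (\<Prod>i\<in>UNIV. real (j i choose \<beta> i) / real (d choose \<beta> i)) * bernstein_poly u d j)"
proof -
  have "(\<Prod>i\<in>UNIV. u i ^ \<beta> i) = (\<Prod>i\<in>UNIV. \<Sum>j\<le>d.
      const_poly (real (j choose \<beta> i) / real (d choose \<beta> i)) *
      (of_nat (d choose j) * u i ^ j * (1 - u i) ^ (d - j)))"
    using assms by (intro prod.cong power_eq_sum_const_poly) auto
  also have "\<dots> = (\<Sum>j\<in>multi_indices d. \<Prod>i\<in>UNIV.
      const_poly (real (j i choose \<beta> i) / real (d choose \<beta> i)) *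
      (of_nat (d choose j i) * u i ^ j i * (1 - u i) ^ (d - j i)))"
    unfolding multi_indices_def by (rule prod_sum_PiE) auto
  finally show ?thesis
    by (simp add: bernstein_poly_def prod.distrib const_poly_prod)
qed

text \<open>The affine coordinate that carries \<open>[- N, N]\<close> onto \<open>[0, 1]\<close>.
  Both it and its complement to 1 are positive multiples of the bounds \<open>N + X\<^sub>i\<close>
  and \<open>N - X\<^sub>i\<close>.\<close>

definition box_coord :: "real \<Rightarrow> 'v \<Rightarrow> 'v::finite rpoly" where
  "box_coord N i = const_poly (inverse (2 * N)) * (const_poly N + coord_poly i)"

text \<open>The point of the box whose box coordinates are the fractions
  \<open>j i / d\<close>.\<close>

definition grid_point :: "real \<Rightarrow> nat \<Rightarrow> ('v \<Rightarrow> nat) \<Rightarrow> real ^ 'v::finite" where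
  "grid_point N d j = (\<chi> i. N * (2 * (real (j i) / real d) - 1))"

lemma eval_box_coord_grid_point:
  "N \<noteq> 0 \<Longrightarrow> eval_poly (box_coord N i) (grid_point N d j) = real (j i) / real d"
  by (simp add: box_coord_def grid_point_def field_simps)

lemma coord_poly_eq_box_coord:
  assumes "N \<noteq> 0"
  shows "coord_poly i = const_poly (2 * N) * box_coord N i + const_poly (- N)"
proof -
  have "const_poly (2 * N) * box_coord N i = const_poly N + coord_poly i"
    using assms by (simp add: box_coord_def flip: mult.assoc const_poly_mult)
  then show ?thesis
    by (simp add: const_poly_uminus)
qed

text \<open>Bernstein coefficients of \<open>p\<close> converge uniformly to the values of
  \<open>p\<close> at the grid points. Asking this for all large \<open>d\<close>, not just for some
  \<open>d\<close>, lets finitely many polynomials share one degree.\<close>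

definition bernstein_approx :: "real \<Rightarrow> 'v::finite rpoly \<Rightarrow> bool" where
  "bernstein_approx N p \<longleftrightarrow> (\<forall>\<epsilon>>0. \<forall>\<^sub>F d in sequentially. \<exists>c.
    p = (\<Sum>j\<in>multi_indices d. const_poly (c j) * bernstein_poly (box_coord N) d j) \<and>
    (\<forall>j\<in>multi_indices d. \<bar>c j - eval_poly p (grid_point N d j)\<bar> \<le> \<epsilon>))"

text \<open>The coefficients are products of binomial ratios, the grid values products of powers of
  \<open>j i / d\<close>. All factors lie in the unit interval, so the products differ by at most
  the sum of the factorwise errors, which tends to 0.\<close>

lemma bernstein_approx_power_prod:
  fixes \<beta> :: "'v::finite \<Rightarrow> nat"
  assumes "N \<noteq> 0"
  shows "bernstein_approx N (\<Prod>i\<in>UNIV. box_coord N i ^ \<beta> i)"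
  unfolding bernstein_approx_def
proof (intro allI impI)
  fix \<epsilon> :: real assume "\<epsilon> > 0"
  have "((\<lambda>d. \<Sum>i\<in>UNIV. (real (\<beta> i))\<^sup>2 / (real d - real (\<beta> i))) \<longlongrightarrow> 0) sequentially"
    using binomial_ratio_tendsto by (intro tendsto_null_sum) blast
  from order_tendstoD(2)[OF this \<open>\<epsilon> > 0\<close>]
  have small: "\<forall>\<^sub>F d in sequentially. (\<Sum>i\<in>UNIV. (real (\<beta> i))\<^sup>2 / (real d - real (\<beta> i))) < \<epsilon>" .
  have "\<forall>\<^sub>F d in sequentially. d > \<beta> i" for i
    by (rule eventually_gt_at_top)
  then have large: "\<forall>\<^sub>F d in sequentially. \<forall>i. d > \<beta> i"
    by (simp add: eventually_all_finite)
  show "\<forall>\<^sub>F d in sequentially. \<exists>c.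
    (\<Prod>i\<in>UNIV. box_coord N i ^ \<beta> i) =
      (\<Sum>j\<in>multi_indices d. const_poly (c j) * bernstein_poly (box_coord N) d j) \<and>
    (\<forall>j\<in>multi_indices d.
      \<bar>c j - eval_poly (\<Prod>i\<in>UNIV. box_coord N i ^ \<beta> i) (grid_point N d j)\<bar> \<le> \<epsilon>)"
    using small large
  proof eventually_elim
    case (elim d)
    let ?c = "\<lambda>j. \<Prod>i\<in>UNIV. real (j i choose \<beta> i) / real (d choose \<beta> i)"
    have "\<bar>?c j - (\<Prod>i\<in>UNIV. (real (j i) / real d) ^ \<beta> i)\<bar> \<le> \<epsilon>"
      if j: "j \<in> multi_indices d" for j
    proof -
      have "norm (?c j - (\<Prod>i\<in>UNIV. (real (j i) / real d) ^ \<beta> i)) \<le>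
          (\<Sum>i\<in>UNIV. norm (real (j i choose \<beta> i) / real (d choose \<beta> i) - (real (j i) / real d) ^ \<beta> i))"
      proof (rule norm_prod_diff)
        fix i
        show "norm (real (j i choose \<beta> i) / real (d choose \<beta> i)) \<le> 1"
          using multi_indices_le[OF j, of i] binomial_right_mono[of "j i" d "\<beta> i"]
          by (auto simp: divide_le_eq_1)
        show "norm ((real (j i) / real d) ^ \<beta> i) \<le> 1"
          using multi_indices_le[OF j, of i] power_le_one[of "real (j i) / real d" "\<beta> i"]
          by (auto simp: divide_le_eq_1)
      qed
      also have "\<dots> \<le> (\<Sum>i\<in>UNIV. (real (\<beta> i))\<^sup>2 / (real d - real (\<beta> i)))"
        using elim(2) multi_indices_le[OF j] by (intro sum_mono) (simp add: binomial_ratio_approx)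
      finally show ?thesis
        using elim(1) by simp
    qed
    moreover have "\<beta> i \<le> d" for i
      using elim(2) by (simp add: less_imp_le)
    ultimately show ?case
      using assms
      by (intro exI[of _ ?c]) (auto simp: power_prod_eq_bernstein_sum eval_box_coord_grid_point)
  qed
qed

lemma bernstein_approx_add:
  assumes "bernstein_approx N p" "bernstein_approx N q"
  shows "bernstein_approx N (p + q)"
  unfolding bernstein_approx_def
proof (intro allI impI)
  fix \<epsilon> :: real assume "\<epsilon> > 0"
  then have "\<epsilon> / 2 > 0" by simp
  show "\<forall>\<^sub>F d in sequentially. \<exists>c.
    p + q = (\<Sum>j\<in>multi_indices d. const_poly (c j) * bernstein_poly (box_coord N) d j) \<and>
    (\<forall>j\<in>multi_indices d. \<bar>c j - eval_poly (p + q) (grid_point N d j)\<bar> \<le> \<epsilon>)"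
    using assms[unfolded bernstein_approx_def, rule_format, OF \<open>\<epsilon> / 2 > 0\<close>]
  proof eventually_elim
    case (elim d)
    then obtain b c where
      "p = (\<Sum>j\<in>multi_indices d. const_poly (b j) * bernstein_poly (box_coord N) d j)"
      and b: "\<forall>j\<in>multi_indices d. \<bar>b j - eval_poly p (grid_point N d j)\<bar> \<le> \<epsilon> / 2"
      and "q = (\<Sum>j\<in>multi_indices d. const_poly (c j) * bernstein_poly (box_coord N) d j)"
      and c: "\<forall>j\<in>multi_indices d. \<bar>c j - eval_poly q (grid_point N d j)\<bar> \<le> \<epsilon> / 2"
      by blast
    then have "p + q =
        (\<Sum>j\<in>multi_indices d. const_poly (b j + c j) * bernstein_poly (box_coord N) d j)"
      by (simp add: const_poly_add distrib_right sum.distrib)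
    moreover have "\<bar>(b j + c j) - eval_poly (p + q) (grid_point N d j)\<bar> \<le> \<epsilon>"
      if "j \<in> multi_indices d" for j
      using b[rule_format, OF that] c[rule_format, OF that] unfolding eval_poly_add by linarith
    ultimately show ?case
      by (intro exI[of _ "\<lambda>j. b j + c j"]) blast
  qed
qed

lemma bernstein_approx_const_mult:
  assumes "bernstein_approx N p"
  shows "bernstein_approx N (const_poly a * p)"
  unfolding bernstein_approx_def
proof (intro allI impI)
  fix \<epsilon> :: real assume "\<epsilon> > 0"
  \<comment> \<open>Adding 1 to \<open>\<bar>a\<bar>\<close> keeps the denominator positive for
    \<open>a = 0\<close>.\<close>
  then have pos: "\<epsilon> / (\<bar>a\<bar> + 1) > 0" by simp
  show "\<forall>\<^sub>F d in sequentially. \<exists>c.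
    const_poly a * p = (\<Sum>j\<in>multi_indices d. const_poly (c j) * bernstein_poly (box_coord N) d j) \<and>
    (\<forall>j\<in>multi_indices d. \<bar>c j - eval_poly (const_poly a * p) (grid_point N d j)\<bar> \<le> \<epsilon>)"
    using assms[unfolded bernstein_approx_def, rule_format, OF pos]
  proof eventually_elim
    case (elim d)
    then obtain b where
      p: "p = (\<Sum>j\<in>multi_indices d. const_poly (b j) * bernstein_poly (box_coord N) d j)"
      and b: "\<forall>j\<in>multi_indices d. \<bar>b j - eval_poly p (grid_point N d j)\<bar> \<le> \<epsilon> / (\<bar>a\<bar> + 1)"
      by blast
    from p have "const_poly a * p =
        (\<Sum>j\<in>multi_indices d. const_poly (a * b j) * bernstein_poly (box_coord N) d j)"
      by (simp add: const_poly_mult sum_distrib_left mult.assoc)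
    moreover have "\<bar>a * b j - eval_poly (const_poly a * p) (grid_point N d j)\<bar> \<le> \<epsilon>"
      if "j \<in> multi_indices d" for j
    proof -
      have "\<bar>a * b j - eval_poly (const_poly a * p) (grid_point N d j)\<bar> =
          \<bar>a\<bar> * \<bar>b j - eval_poly p (grid_point N d j)\<bar>"
        by (simp flip: abs_mult right_diff_distrib)
      also have "\<dots> \<le> \<bar>a\<bar> * (\<epsilon> / (\<bar>a\<bar> + 1))"
        using b[rule_format, OF that] by (intro mult_left_mono) auto
      also have "\<dots> \<le> \<epsilon>"
        using \<open>\<epsilon> > 0\<close> by (simp add: field_simps)
      finally show ?thesis .
    qed
    ultimately show ?case
      by (intro exI[of _ "\<lambda>j. a * b j"]) blast
  qed
qed

lemma bernstein_approx_all:
  fixes p :: "'v::finite rpoly"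
  assumes "N \<noteq> 0"
  shows "bernstein_approx N p"
proof -
  \<comment> \<open>Unlike \<open>bernstein_approx N p\<close> itself, this strengthening passes from \<open>p\<close> to \<open>X\<^sub>i p\<close> at once.\<close>
  have "bernstein_approx N (p * (\<Prod>i\<in>UNIV. box_coord N i ^ \<beta> i))" for \<beta>
  proof (induction p arbitrary: \<beta> rule: rpoly_induct)
    case (const c)
    show ?case
      by (intro bernstein_approx_const_mult bernstein_approx_power_prod assms)
  next
    case (add p q)
    then show ?case
      by (simp add: distrib_right bernstein_approx_add)
  next
    case (coord l p)
    have "(\<Prod>i\<in>UNIV. box_coord N i ^ (\<beta>(l := Suc (\<beta> l))) i) =
        (\<Prod>i\<in>UNIV. (if i = l then box_coord N i else 1) * box_coord N i ^ \<beta> i)"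
      by (rule prod.cong) auto
    also have "\<dots> = box_coord N l * (\<Prod>i\<in>UNIV. box_coord N i ^ \<beta> i)"
      by (simp add: prod.distrib)
    \<comment> \<open>Since the variable is \<open>2 * N\<close> times its box coordinate minus
      \<open>N\<close>, multiplying by it gives two instances of the induction hypothesis:
      \<open>\<beta>\<close> raised by one at \<open>l\<close>, and \<open>\<beta>\<close>
      itself.\<close>
    finally have "coord_poly l * p * (\<Prod>i\<in>UNIV. box_coord N i ^ \<beta> i) =
        const_poly (2 * N) * (p * (\<Prod>i\<in>UNIV. box_coord N i ^ (\<beta>(l := Suc (\<beta> l))) i)) +
        const_poly (- N) * (p * (\<Prod>i\<in>UNIV. box_coord N i ^ \<beta> i))"
      unfolding coord_poly_eq_box_coord[OF assms] by (simp add: algebra_simps)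
    moreover have "bernstein_approx N (const_poly (2 * N) * (p * (\<Prod>i\<in>UNIV. box_coord N i ^ (\<beta>(l := Suc (\<beta> l))) i)) +
        const_poly (- N) * (p * (\<Prod>i\<in>UNIV. box_coord N i ^ \<beta> i)))"
      by (intro bernstein_approx_add bernstein_approx_const_mult coord.IH)
    ultimately show ?case by simp
  qed
  from this[of "\<lambda>_. 0"] show ?thesis by simp
qed

subsection \<open>Positive semidefinite constant matrices\<close>

text \<open>Read as a quadratic polynomial in \<open>c\<close>; its non-negativity drives both cases
  of the elimination below.\<close>

lemma quadratic_form_add_axis:
  fixes C :: "real ^ 't::finite ^ 't"
  assumes "transpose C = C"
  shows "(v + c *\<^sub>R axis i 1) \<bullet> (C *v (v + c *\<^sub>R axis i 1)) =
    v \<bullet> (C *v v) + 2 * c * (C $ i \<bullet> v) + c\<^sup>2 * C $ i $ i"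
proof -
  have "v \<bullet> (C *v axis i 1) = (C *v v) $ i"
    by (metis assms dot_lmul_matrix inner_axis' inner_commute mult_1 real_inner_1_left
        transpose_matrix_vector)
  moreover have "(C *v axis i 1) $ i = C $ i $ i"
    by (simp add: matrix_vector_mult_basis column_def)
  ultimately show ?thesis
    by (simp add: matrix_vector_right_distrib matrix_vector_mult_scaleR inner_add_left
        inner_add_right inner_axis' power2_eq_square matrix_vector_mul_component algebra_simps)
qed

text \<open>Symmetric Gaussian elimination, by induction on a set \<open>I\<close> outside which all
  rows vanish. A zero diagonal entry forces its whole row to vanish; a positive one lets a rank-one
  square with positive weight be split off.\<close>

lemma psd_const_matrix_in_weighted_matrix_squares:
  fixes C :: "real ^ 't::finite ^ 't" and S :: "'v rpoly set"
  assumes "finite I" "\<And>a b. a \<notin> I \<Longrightarrow> C $ a $ b = 0" "transpose C = C"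
    "\<And>v. v \<bullet> (C *v v) \<ge> 0"
    and S: "\<And>c. c \<ge> 0 \<Longrightarrow> const_poly c \<in> S"
  shows "map_matrix const_poly C \<in> weighted_matrix_squares S"
  using assms(1-4)
proof (induction I arbitrary: C rule: finite_induct)
  case empty
  then have "(map_matrix const_poly C :: 'v rpoly ^ 't ^ 't) = 0"
    by (simp add: vec_eq_iff)
  then show ?case
    by (simp add: weighted_matrix_squares_0)
next
  case (insert i I)
  have sym: "C $ a $ b = C $ b $ a" for a b
    using insert.prems(2) by (metis transpose_def vec_lambda_beta)
  have quad: "v \<bullet> (C *v v) + 2 * c * (C $ i \<bullet> v) + c\<^sup>2 * C $ i $ i \<ge> 0" for v c
    using insert.prems(3)[of "v + c *\<^sub>R axis i 1"] quadratic_form_add_axis[OF insert.prems(2)] by simp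
  from quad[of 0 1] have "C $ i $ i \<ge> 0" by simp
  \<comment> \<open>If the diagonal entry is positive, pass to its Schur complement.\<close>
  show ?case
  proof (cases "C $ i $ i = 0")
    case True
    have zero: "C $ i $ b = 0" for b
    proof (rule ccontr)
      assume nz: "C $ i $ b \<noteq> 0"
      define q where "q = axis b 1 \<bullet> (C *v axis b 1)"
      \<comment> \<open>With a zero diagonal entry the quadratic in \<open>c\<close> becomes linear,
        and a non-zero slope would make it negative at the \<open>c\<close> inserted next.\<close>
      have "q + 2 * c * C $ i $ b \<ge> 0" for c
        using quad[of "axis b 1" c] True by (simp add: q_def inner_axis)
      then have "q + 2 * (- (\<bar>q\<bar> + 1) / (2 * C $ i $ b)) * C $ i $ b \<ge> 0" .
      moreover have "2 * (- (\<bar>q\<bar> + 1) / (2 * C $ i $ b)) * C $ i $ b = - (\<bar>q\<bar> + 1)"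
        using nz by simp
      ultimately show False
        by linarith
    qed
    have "C $ a $ b = 0" if "a \<notin> I" for a b
      using zero insert.prems(1) that by (cases "a = i") auto
    from insert.IH[OF this insert.prems(2,3)] show ?thesis by blast
  next
    case False
    with \<open>C $ i $ i \<ge> 0\<close> have d: "C $ i $ i > 0" by simp
    define C' where "C' = (\<chi> a b. C $ a $ b - C $ i $ a * C $ i $ b / C $ i $ i)"
    \<comment> \<open>Row \<open>i\<close> of \<open>C\<close> placed in a zero matrix, so that
      \<open>transpose A ** A\<close> is the outer product of that row with itself.\<close>
    define A :: "'v rpoly ^ 't ^ 't" where "A = (\<chi> a b. if a = i then const_poly (C $ i $ b) else 0)"
    have A: "(transpose A ** A) $ a $ b = const_poly (C $ i $ a) * const_poly (C $ i $ b)" for a b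
    proof -
      have "(transpose A ** A) $ a $ b =
          (\<Sum>r\<in>UNIV. if r = i then const_poly (C $ i $ a) * const_poly (C $ i $ b) else 0)"
        unfolding matrix_matrix_mult_def transpose_def A_def vec_lambda_beta by (rule sum.cong) auto
      then show ?thesis by simp
    qed
    have decomp: "map_matrix const_poly C = map_matrix const_poly C' +
        map_matrix ((*) (const_poly (inverse (C $ i $ i)))) (transpose A ** A)"
      unfolding vec_eq_iff
      by (simp add: A C'_def divide_inverse mult.commute flip: const_poly_add const_poly_mult)
    have "C' $ a $ b = 0" if "a \<notin> I" for a b
      using insert.prems(1)[of a b] insert.prems(1)[of a i] sym[of i a] that d
      by (cases "a = i") (auto simp: C'_def)
    moreover have "transpose C' = C'"
      using sym by (simp add: vec_eq_iff transpose_def C'_def mult.commute)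
    moreover have "v \<bullet> (C' *v v) \<ge> 0" for v
    proof -
      have "C' *v v = C *v v - ((C $ i \<bullet> v) / C $ i $ i) *\<^sub>R C $ i"
        unfolding vec_eq_iff
        by (simp add: C'_def matrix_vector_mult_def inner_vec_def algebra_simps sum_subtractf
            sum_distrib_left sum_divide_distrib)
      then have "v \<bullet> (C' *v v) = v \<bullet> (C *v v) - (C $ i \<bullet> v)\<^sup>2 / C $ i $ i"
        by (simp add: inner_diff_right inner_commute power2_eq_square)
      \<comment> \<open>Completing the square: this is the quadratic in \<open>c\<close> at its
        minimiser \<open>- (C $ i \<bullet> v) / C $ i $ i\<close>.\<close>
      also have "\<dots> = v \<bullet> (C *v v) + 2 * (- (C $ i \<bullet> v) / C $ i $ i) * (C $ i \<bullet> v)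
          + (- (C $ i \<bullet> v) / C $ i $ i)\<^sup>2 * C $ i $ i"
        using d by (simp add: field_simps power2_eq_square)
      also have "\<dots> \<ge> 0" by (rule quad)
      finally show ?thesis .
    qed
    ultimately have "map_matrix const_poly C' \<in> weighted_matrix_squares S"
      by (rule insert.IH)
    moreover have "const_poly (inverse (C $ i $ i)) \<in> S"
      using d by (intro S) simp
    ultimately show ?thesis
      unfolding decomp by (rule weighted_matrix_squares_add_term)
  qed
qed

subsection \<open>Positivity on the box\<close>

lemma bernstein_poly_in_generated_semiring:
  fixes g :: "nat \<Rightarrow> 'v::finite rpoly"
  assumes "N > 0" "\<And>i. const_poly N + coord_poly i \<in> generated_semiring k g"
    "\<And>i. const_poly N - coord_poly i \<in> generated_semiring k g"
  shows "bernstein_poly (box_coord N) d j \<in> generated_semiring k g"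
proof -
  have "1 - box_coord N i = const_poly (inverse (2 * N)) * (const_poly N - coord_poly i)" for i :: 'v
  proof -
    have "const_poly (inverse (2 * N)) * (const_poly N + const_poly N) = (1 :: 'v rpoly)"
      using \<open>N > 0\<close> by (simp flip: const_poly_add const_poly_mult)
    then show ?thesis
      by (simp add: box_coord_def algebra_simps)
  qed
  then show ?thesis
    using assms unfolding bernstein_poly_def
    by (auto simp: box_coord_def intro!: generated_semiring_prod generated_semiring_mult
        generated_semiring_power generated_semiring_of_nat generated_semiring_const)
qed

lemma symmetric_matrix_nth: "transpose A = A \<Longrightarrow> A $ a $ b = A $ b $ a"
  by (drule arg_cong[of _ _ "\<lambda>M. M $ b $ a"]) (simp add: transpose_def)

text \<open>A crude bound suffices: each component of \<open>v\<close> is at most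
  \<open>norm v\<close>, and there are \<open>CARD('t)\<close> squared terms.\<close>

lemma abs_quadratic_form_le:
  fixes A :: "real ^ 't::finite ^ 't"
  assumes "\<And>a b. \<bar>A $ a $ b\<bar> \<le> \<epsilon>"
  shows "\<bar>v \<bullet> (A *v v)\<bar> \<le> \<epsilon> * (real CARD('t))\<^sup>2 * (norm v)\<^sup>2"
proof -
  have "v \<bullet> (A *v v) = (\<Sum>a\<in>UNIV. \<Sum>b\<in>UNIV. v $ a * (A $ a $ b * v $ b))"
    by (simp add: inner_vec_def matrix_vector_mult_def sum_distrib_left)
  also have "\<bar>\<dots>\<bar> \<le> (\<Sum>a\<in>UNIV. \<Sum>b\<in>UNIV. \<bar>v $ a * (A $ a $ b * v $ b)\<bar>)"
    by (intro order.trans[OF sum_abs] sum_mono) auto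
  also have "\<dots> \<le> (\<Sum>a\<in>(UNIV :: 't set). \<Sum>b\<in>(UNIV :: 't set). norm v * (\<epsilon> * norm v))"
  proof (intro sum_mono)
    fix a b
    have "0 \<le> \<epsilon>"
      using assms[of a b] by linarith
    then show "\<bar>v $ a * (A $ a $ b * v $ b)\<bar> \<le> norm v * (\<epsilon> * norm v)"
      unfolding abs_mult by (intro mult_mono assms component_le_norm_cart) auto
  qed
  also have "\<dots> = \<epsilon> * (real CARD('t))\<^sup>2 * (norm v)\<^sup>2"
    by (simp add: power2_eq_square)
  finally show ?thesis .
qed

text \<open>Expanding all entries in one Bernstein basis writes \<open>H\<close> as a sum of
  Bernstein polynomials times constant matrices \<open>C j\<close>. Each \<open>C j\<close> is so
  close to the value of \<open>H\<close> at a grid point of the box that it stays positive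
  semidefinite, hence is a weighted sum of squares; the Bernstein polynomials become
  weights.\<close>

lemma positive_on_box_in_weighted_matrix_squares:
  fixes g :: "nat \<Rightarrow> 'v::finite rpoly" and H :: "'v rpoly ^ 't::finite ^ 't"
  assumes "N > 0" "\<And>i. const_poly N + coord_poly i \<in> generated_semiring k g"
    "\<And>i. const_poly N - coord_poly i \<in> generated_semiring k g"
    and sym: "transpose H = H" and "\<delta> > 0"
    and pos: "\<And>x v. (\<And>i. \<bar>x $ i\<bar> \<le> N) \<Longrightarrow>
      v \<bullet> (map_matrix (\<lambda>p. eval_poly p x) H *v v) \<ge> \<delta> * (norm v)\<^sup>2"
  shows "H \<in> weighted_matrix_squares (generated_semiring k g)"
proof -
  let ?B = "bernstein_poly (box_coord N) :: nat \<Rightarrow> ('v \<Rightarrow> nat) \<Rightarrow> 'v rpoly"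
  have H_sym: "H $ a $ b = H $ b $ a" for a b
    using sym by (rule symmetric_matrix_nth)
  \<comment> \<open>Chosen so that an entrywise error \<open>\<epsilon>\<close> changes the
    quadratic form by at most \<open>\<delta> * (norm v)\<^sup>2\<close>, by
    \<open>abs_quadratic_form_le\<close>.\<close>
  define \<epsilon> where "\<epsilon> = \<delta> / (real CARD('t))\<^sup>2"
  have "\<epsilon> > 0"
    using \<open>\<delta> > 0\<close> by (simp add: \<epsilon>_def)
  define Q where "Q a b d c \<longleftrightarrow>
    H $ a $ b = (\<Sum>j\<in>multi_indices d. const_poly (c j) * ?B d j) \<and>
    (\<forall>j\<in>multi_indices d. \<bar>c j - eval_poly (H $ a $ b) (grid_point N d j)\<bar> \<le> \<epsilon>)" for a b d c
  have "\<forall>\<^sub>F d in sequentially. \<exists>c. Q a b d c" for a b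
    using bernstein_approx_all[of N "H $ a $ b"] \<open>N > 0\<close> \<open>\<epsilon> > 0\<close>
    unfolding bernstein_approx_def Q_def by simp
  \<comment> \<open>Finitely many entries, each good for all large degrees, admit a common
    degree.\<close>
  then have "\<forall>\<^sub>F d in sequentially. \<forall>a b. \<exists>c. Q a b d c"
    by (simp add: eventually_all_finite)
  from eventually_happens'[OF sequentially_bot this] obtain d where "\<forall>a b. \<exists>c. Q a b d c"
    by blast
  then obtain c where Q: "\<And>a b. Q a b d (c a b)"
    by metis
  have c: "H $ a $ b = (\<Sum>j\<in>multi_indices d. const_poly (c a b j) * ?B d j)" for a b
    using Q[of a b] unfolding Q_def by (rule conjunct1)
  have c_approx: "\<bar>c a b j - eval_poly (H $ a $ b) (grid_point N d j)\<bar> \<le> \<epsilon>"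
    if "j \<in> multi_indices d" for a b j
    using Q[of a b] that unfolding Q_def by blast
  \<comment> \<open>The coefficients at \<open>(a, b)\<close> and \<open>(b, a)\<close> were chosen
    independently; averaging restores symmetry and, as \<open>H\<close> is symmetric, preserves both
    the expansion and the error bound.\<close>
  define C where "C j = (\<chi> a b. (c a b j + c b a j) / 2)" for j
  have "H = (\<Sum>j\<in>multi_indices d. map_matrix ((*) (?B d j)) (map_matrix const_poly (C j)))"
  proof -
    have "H $ a $ b = (\<Sum>j\<in>multi_indices d. const_poly ((c a b j + c b a j) / 2) * ?B d j)" for a b
    proof -
      have "H $ a $ b = const_poly (1/2 + 1/2) * H $ a $ b"
        by simp
      also have "\<dots> = const_poly (1/2) * H $ a $ b + const_poly (1/2) * H $ b $ a"
        unfolding const_poly_add by (simp only: distrib_right H_sym[of b a])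
      also have "\<dots> = (\<Sum>j\<in>multi_indices d. (const_poly (1/2) * const_poly (c a b j) +
          const_poly (1/2) * const_poly (c b a j)) * ?B d j)"
        unfolding c[of a b] c[of b a] by (simp add: sum_distrib_left distrib_right sum.distrib mult.assoc)
      also have "\<dots> = (\<Sum>j\<in>multi_indices d. const_poly ((c a b j + c b a j) / 2) * ?B d j)"
        by (simp add: add_divide_distrib flip: const_poly_mult const_poly_add)
      finally show ?thesis .
    qed
    then show ?thesis
      by (simp add: vec_eq_iff C_def mult.commute)
  qed
  moreover have "map_matrix const_poly (C j) \<in> weighted_matrix_squares (generated_semiring k g)"
    if j: "j \<in> multi_indices d" for j
  proof (rule psd_const_matrix_in_weighted_matrix_squares[where I = UNIV])
    show "transpose (C j) = C j"
      by (simp add: vec_eq_iff transpose_def C_def add.commute)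
    fix v :: "real ^ 't"
    let ?x = "grid_point N d j"
    let ?H = "map_matrix (\<lambda>p. eval_poly p ?x) H"
    have "\<bar>?x $ i\<bar> \<le> N" for i
    proof -
      \<comment> \<open>For \<open>d = 0\<close> the quotient is 0 by convention, so the bounds hold
        there too.\<close>
      have "0 \<le> real (j i) / real d" "real (j i) / real d \<le> 1"
        using multi_indices_le[OF j, of i] by (auto simp: divide_le_eq_1)
      then have "\<bar>2 * (real (j i) / real d) - 1\<bar> \<le> 1"
        by linarith
      from mult_left_mono[OF this, of N] show ?thesis
        using \<open>N > 0\<close> by (simp add: grid_point_def abs_mult)
    qed
    then have "v \<bullet> (?H *v v) \<ge> \<delta> * (norm v)\<^sup>2"
      by (rule pos)
    moreover have "\<bar>v \<bullet> ((C j - ?H) *v v)\<bar> \<le> \<epsilon> * (real CARD('t))\<^sup>2 * (norm v)\<^sup>2"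
    proof (rule abs_quadratic_form_le)
      fix a b
      have "(C j - ?H) $ a $ b = (c a b j + c b a j) / 2 - eval_poly (H $ a $ b) ?x"
        by (simp add: C_def)
      then show "\<bar>(C j - ?H) $ a $ b\<bar> \<le> \<epsilon>"
        using c_approx[OF j, of a b] c_approx[OF j, of b a] H_sym[of a b] by (simp add: abs_le_iff)
    qed
    moreover have "v \<bullet> (C j *v v) = v \<bullet> (?H *v v) + v \<bullet> ((C j - ?H) *v v)"
      by (simp add: matrix_vector_mult_diff_rdistrib inner_diff_right)
    ultimately show "v \<bullet> (C j *v v) \<ge> 0"
      by (simp add: \<epsilon>_def)
  qed (auto intro: generated_semiring_const)
  ultimately show ?thesis
    using bernstein_poly_in_generated_semiring[OF assms(1-3)]
    by (auto intro!: weighted_matrix_squares_sum weighted_matrix_squares_smult generated_semiring_mult)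
qed

section \<open>Reduction from \<open>K(G)\<close> to the box by a penalty term\<close>

lemma penalty_le:
  fixes y :: real
  assumes "y \<le> 1" "M \<ge> 1"
  shows "y * (1 - y) ^ M \<le> 1 / real M - real M * (max 0 (- y))\<^sup>2"
proof (cases "y \<ge> 0")
  case True
  \<comment> \<open>Bernoulli's inequality pairs \<open>1 - y\<close> with \<open>1 + y\<close>;
    their product \<open>1 - y\<^sup>2\<close> is at most 1, which leaves the bound
    \<open>1 / M\<close>.\<close>
  have "(1 + real M * y) * (1 - y) ^ M \<le> (1 + y) ^ M * (1 - y) ^ M"
    using assms True by (intro mult_right_mono Bernoulli_inequality) auto
  also have "\<dots> = (1 - y\<^sup>2) ^ M"
    by (simp add: power2_eq_square algebra_simps flip: power_mult_distrib)
  also have "\<dots> \<le> 1"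
    using assms True by (intro power_le_one) (auto simp: power_le_one)
  finally have "real M * (y * (1 - y) ^ M) \<le> 1 - (1 - y) ^ M"
    by (simp add: algebra_simps)
  also have "\<dots> \<le> 1"
    using assms by simp
  finally show ?thesis
    using True assms by (simp add: field_simps)
next
  case False
  \<comment> \<open>For negative \<open>y\<close> the power itself grows at least linearly in
    \<open>M\<close>, and multiplying by \<open>y\<close> yields at most
    \<open>- M * y\<^sup>2\<close>.\<close>
  have "1 + real M * (- y) \<le> (1 + (- y)) ^ M"
    using False by (intro Bernoulli_inequality) auto
  then have "y * (1 - y) ^ M \<le> y * (real M * (- y))"
    using False by (intro mult_left_mono_neg) auto
  also have "\<dots> \<le> 1 / real M - real M * (max 0 (- y))\<^sup>2"
    using False by (simp add: power2_eq_square)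
  finally show ?thesis .
qed

lemma continuous_on_quadratic_form_eval:
  fixes F :: "'v::finite rpoly ^ 't::finite ^ 't"
  shows "continuous_on S (\<lambda>z. snd z \<bullet> (map_matrix (\<lambda>p. eval_poly p (fst z)) F *v snd z))"
  unfolding inner_vec_def matrix_vector_mult_def
  by (simp, intro continuous_intros)

text \<open>On the compact product \<open>Z\<close> of the box and the unit sphere, \<open>q\<close>
  is the quadratic form and \<open>\<rho>\<close> the total squared violation of the constraints.
  Their maximum is positive: either a constraint fails or \<open>F\<close> is positive definite
  there. Let \<open>\<delta>\<close> be its minimum. Where \<open>q \<ge> \<delta>\<close> the
  penalty costs at most \<open>k / M\<close>; elsewhere \<open>\<rho> \<ge> \<delta>\<close>, and
  the gain \<open>M * \<rho>\<close> outweighs the most negative value of \<open>q\<close>. The even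
  exponent makes the power a square.\<close>

lemma positivity_certificate:
  fixes F :: "'v::finite rpoly ^ 't::finite ^ 't" and g :: "nat \<Rightarrow> 'v rpoly"
  assumes le1: "\<forall>l\<in>{1..k}. \<forall>x. (\<forall>i. \<bar>x $ i\<bar> \<le> N) \<longrightarrow> eval_poly (g l) x \<le> 1"
    and pos: "\<And>x. x \<in> nonneg_set (g ` {1..k}) \<Longrightarrow> positive_definite (map_matrix (\<lambda>p. eval_poly p x) F)"
    and "N > 0"
  obtains n \<delta> where "\<delta> > 0" "\<forall>x v. (\<forall>i. \<bar>x $ i\<bar> \<le> N) \<longrightarrow> norm v = 1 \<longrightarrow>
    v \<bullet> (map_matrix (\<lambda>p. eval_poly p x) F *v v) -
      (\<Sum>l\<in>{1..k}. eval_poly (g l) x * (1 - eval_poly (g l) x) ^ (2 * n)) \<ge> \<delta>"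
proof -
  define Z :: "((real ^ 'v) \<times> (real ^ 't)) set"
    where "Z = cbox (\<chi> i. - N) (\<chi> i. N) \<times> sphere 0 1"
  define q where "q z = snd z \<bullet> (map_matrix (\<lambda>p. eval_poly p (fst z)) F *v snd z)" for z
  define \<rho> where "\<rho> z = (\<Sum>l\<in>{1..k}. (max 0 (- eval_poly (g l) (fst z)))\<^sup>2)"
    for z :: "(real ^ 'v) \<times> (real ^ 't)"
  have Z_iff: "(x, v) \<in> Z \<longleftrightarrow> (\<forall>i. \<bar>x $ i\<bar> \<le> N) \<and> norm v = 1" for x v
    by (auto simp: Z_def mem_box_cart abs_le_iff minus_le_iff)
  have "compact Z"
    unfolding Z_def by (intro compact_Times compact_cbox compact_sphere)
  \<comment> \<open>An arbitrary index gives a unit vector, so the minima below are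
    attained.\<close>
  have "(0, axis (SOME i. True) 1) \<in> Z"
    using \<open>N > 0\<close> by (simp add: Z_iff)
  then have "Z \<noteq> {}" by blast
  have cont_q: "continuous_on Z q"
    unfolding q_def by (rule continuous_on_quadratic_form_eval)
  have cont_\<rho>: "continuous_on Z \<rho>"
    unfolding \<rho>_def by (intro continuous_intros)
  have \<rho>_nonneg: "\<rho> z \<ge> 0" for z
    by (simp add: \<rho>_def sum_nonneg)
  have max_pos: "max (q z) (\<rho> z) > 0" if "z \<in> Z" for z
  proof (cases "\<rho> z > 0")
    case False
    then have "\<rho> z = 0"
      using \<rho>_nonneg[of z] by simp
    then have "\<forall>l\<in>{1..k}. (max 0 (- eval_poly (g l) (fst z)))\<^sup>2 = 0"
      unfolding \<rho>_def by (subst (asm) sum_nonneg_eq_0_iff) auto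
    then have "fst z \<in> nonneg_set (g ` {1..k})"
      by (auto simp: nonneg_set_def max_def split: if_splits)
    moreover have "snd z \<noteq> 0"
      using that by (auto simp: Z_def)
    ultimately have "q z > 0"
      using pos[of "fst z"] by (simp add: positive_definite_def q_def)
    then show ?thesis by simp
  qed simp
  have "continuous_on Z (\<lambda>z. max (q z) (\<rho> z))"
    by (intro continuous_on_max cont_q cont_\<rho>)
  from continuous_attains_inf[OF \<open>compact Z\<close> \<open>Z \<noteq> {}\<close> this]
  obtain z0 where z0: "z0 \<in> Z" "\<And>z. z \<in> Z \<Longrightarrow> max (q z0) (\<rho> z0) \<le> max (q z) (\<rho> z)"
    by blast
  define \<delta> where "\<delta> = max (q z0) (\<rho> z0)"
  have "\<delta> > 0"
    using max_pos[OF z0(1)] by (simp add: \<delta>_def)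
  from continuous_attains_inf[OF \<open>compact Z\<close> \<open>Z \<noteq> {}\<close> cont_q]
  obtain z1 where z1: "\<And>z. z \<in> Z \<Longrightarrow> q z1 \<le> q z"
    by blast
  define D where "D = \<bar>q z1\<bar>"
  \<comment> \<open>The first ratio lets \<open>M * \<delta>\<close> absorb the lower bound
    \<open>- D\<close> of \<open>q\<close>; the second keeps the total cost \<open>k / M\<close>
    below \<open>\<delta> / 2\<close>.\<close>
  obtain n :: nat where n: "real n \<ge> max 1 (max ((D + \<delta>) / \<delta>) (2 * real k / \<delta>))"
    using real_arch_simple by blast
  define M where "M = 2 * n"
  have "M \<ge> 1" "real M * \<delta> \<ge> D + \<delta>" "real k / real M \<le> \<delta> / 2"
  proof -
    have "real n \<ge> 1" "(D + \<delta>) / \<delta> \<le> real n" "2 * real k / \<delta> \<le> real n"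
      using n by auto
    then have "D + \<delta> \<le> real n * \<delta>" "2 * real k \<le> real n * \<delta>" "n \<ge> 1"
      using \<open>\<delta> > 0\<close> by (auto simp: field_simps)
    moreover have "0 \<le> real n * \<delta>"
      using \<open>\<delta> > 0\<close> by simp
    ultimately have "D + \<delta> \<le> real M * \<delta>" "2 * real k \<le> real M * \<delta>" "M \<ge> 1"
      by (auto simp: M_def algebra_simps)
    then show "M \<ge> 1" "real M * \<delta> \<ge> D + \<delta>" "real k / real M \<le> \<delta> / 2"
      by (auto simp: field_simps)
  qed
  show ?thesis
  proof (rule that[of "\<delta> / 2" n])
    show "\<delta> / 2 > 0" using \<open>\<delta> > 0\<close> by simp
  next
    show "\<forall>x v. (\<forall>i. \<bar>x $ i\<bar> \<le> N) \<longrightarrow> norm v = 1 \<longrightarrow>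
      v \<bullet> (map_matrix (\<lambda>p. eval_poly p x) F *v v) -
        (\<Sum>l\<in>{1..k}. eval_poly (g l) x * (1 - eval_poly (g l) x) ^ (2 * n)) \<ge> \<delta> / 2"
    proof (intro allI impI)
      fix x :: "real ^ 'v" and v :: "real ^ 't"
      assume x: "\<forall>i. \<bar>x $ i\<bar> \<le> N" and v: "norm v = 1"
      let ?z = "(x, v)"
      have "?z \<in> Z"
        using x v by (simp add: Z_iff)
      have "(\<Sum>l\<in>{1..k}. eval_poly (g l) x * (1 - eval_poly (g l) x) ^ M) \<le>
          (\<Sum>l\<in>{1..k}. 1 / real M - real M * (max 0 (- eval_poly (g l) x))\<^sup>2)"
        using le1 x \<open>M \<ge> 1\<close> by (intro sum_mono penalty_le) auto
      also have "\<dots> = real k / real M - real M * \<rho> ?z"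
        by (simp add: \<rho>_def sum_subtractf sum_distrib_left)
      finally have sum_le: "(\<Sum>l\<in>{1..k}. eval_poly (g l) x * (1 - eval_poly (g l) x) ^ M) \<le>
          \<delta> / 2 - real M * \<rho> ?z"
        using \<open>real k / real M \<le> \<delta> / 2\<close> by linarith
      have "q ?z + real M * \<rho> ?z \<ge> \<delta>"
      proof (cases "q ?z \<ge> \<delta>")
        case True
        then show ?thesis
          using \<rho>_nonneg[of ?z] by (simp add: add_increasing2)
      next
        case False
        then have "\<rho> ?z \<ge> \<delta>"
          using z0(2)[OF \<open>?z \<in> Z\<close>] unfolding \<delta>_def[symmetric] le_max_iff_disj by blast
        then have "real M * \<rho> ?z \<ge> real M * \<delta>"
          by (simp add: mult_left_mono)
        moreover have "q ?z \<ge> - D"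
          using z1[OF \<open>?z \<in> Z\<close>] by (simp add: D_def)
        ultimately show ?thesis
          using \<open>real M * \<delta> \<ge> D + \<delta>\<close> by linarith
      qed
      with sum_le have "q ?z - (\<Sum>l\<in>{1..k}. eval_poly (g l) x * (1 - eval_poly (g l) x) ^ M) \<ge> \<delta> / 2"
        by linarith
      then show "v \<bullet> (map_matrix (\<lambda>p. eval_poly p x) F *v v) -
        (\<Sum>l\<in>{1..k}. eval_poly (g l) x * (1 - eval_poly (g l) x) ^ (2 * n)) \<ge> \<delta> / 2"
        by (simp add: q_def M_def)
    qed
  qed
qed

text \<open>The scaling factor is the reciprocal of a bound for \<open>\<bar>p\<bar>\<close> on the
  compact box.\<close>

lemma exists_scaling_le_1_on_box:
  fixes p :: "'v::finite rpoly"
  obtains s where "s > 0" "\<And>x. (\<And>i. \<bar>x $ i\<bar> \<le> N) \<Longrightarrow> eval_poly (const_poly s * p) x \<le> 1"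
proof -
  have "compact (eval_poly p ` cbox (\<chi> i. - N) (\<chi> i. N))"
    by (intro compact_continuous_image compact_cbox continuous_on_eval_poly continuous_on_id)
  then obtain B where B: "B > 0" "\<And>x. x \<in> cbox (\<chi> i. - N) (\<chi> i. N) \<Longrightarrow> \<bar>eval_poly p x\<bar> \<le> B"
    by (auto dest!: compact_imp_bounded simp: bounded_pos)
  show ?thesis
  proof (rule that[of "inverse B"])
    fix x :: "real ^ 'v" assume "\<And>i. \<bar>x $ i\<bar> \<le> N"
    then have "x \<in> cbox (\<chi> i. - N) (\<chi> i. N)"
      by (auto simp: mem_box_cart abs_le_iff minus_le_iff)
    from B(2)[OF this] B(1) show "eval_poly (const_poly (inverse B) * p) x \<le> 1"
      by (simp add: field_simps)
  qed (use B in simp)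
qed

section \<open>Assembling the representation\<close>

lemma transpose_mult_diag:
  fixes p :: "'a::comm_semiring_1"
  defines "D \<equiv> (\<chi> a b. if a = b then p else 0) :: 'a ^ 't::finite ^ 't"
  shows "(transpose D ** D) $ a $ b = (if a = b then p\<^sup>2 else 0)"
proof -
  have "(transpose D ** D) $ a $ b = (\<Sum>r\<in>UNIV. if r = a then (if a = b then p\<^sup>2 else 0) else 0)"
    unfolding matrix_matrix_mult_def transpose_def D_def vec_lambda_beta
    by (rule sum.cong) (auto simp: power2_eq_square)
  then show ?thesis by simp
qed

text \<open>The explicit form uses one length \<open>s\<close> for all weights. The individual
  lengths differ, so each weight is padded with zero coefficients up to the sum of all
  lengths.\<close>

lemma weighted_matrix_squares_explicit:
  fixes F :: "'v rpoly ^ 't::finite ^ 't"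
  assumes "F \<in> weighted_matrix_squares (generated_semiring k g)"
  shows "\<exists>(r::nat) (s::nat) (a :: nat \<Rightarrow> nat \<Rightarrow> real) (\<alpha> :: nat \<Rightarrow> nat \<Rightarrow> nat \<Rightarrow> nat)
        (A :: nat \<Rightarrow> 'v rpoly ^ 't ^ 't).
      (\<forall>i<r. \<forall>j<s. a i j \<ge> 0) \<and>
      F = (\<Sum>i<r. map_matrix ((*) (\<Sum>j<s. const_poly (a i j) * power_product k g (\<alpha> i j)))
                     (transpose (A i) ** A i))"
proof -
  obtain r :: nat and m and A :: "nat \<Rightarrow> 'v rpoly ^ 't ^ 't"
    where F: "F = (\<Sum>i<r. map_matrix ((*) (m i)) (transpose (A i) ** A i))"
    and m: "\<forall>i<r. m i \<in> generated_semiring k g"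
    using assms by (rule weighted_matrix_squaresE)
  define Q where "Q i s a \<alpha> \<longleftrightarrow> m i = (\<Sum>j<s. const_poly (a j) * power_product k g (\<alpha> j)) \<and>
    (\<forall>j<s. a j \<ge> 0)" for i and s :: nat and a \<alpha>
  have "\<exists>s a \<alpha>. Q i s a \<alpha>" if "i < r" for i
    by (rule generated_semiringE[OF m[rule_format, OF that]]) (use Q_def in blast)
  then obtain s :: "nat \<Rightarrow> nat" and a \<alpha> where Q: "\<And>i. i < r \<Longrightarrow> Q i (s i) (a i) (\<alpha> i)"
    by metis
  have m_eq: "m i = (\<Sum>j<s i. const_poly (a i j) * power_product k g (\<alpha> i j))" if "i < r" for i
    using Q[OF that] unfolding Q_def by (rule conjunct1)
  have a: "a i j \<ge> 0" if "i < r" "j < s i" for i j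
    using Q[OF that(1)] that(2) unfolding Q_def by blast
  define s' where "s' = (\<Sum>i<r. s i)"
  define a' where "a' i j = (if j < s i then a i j else 0)" for i j
  have "m i = (\<Sum>j<s'. const_poly (a' i j) * power_product k g (\<alpha> i j))" if "i < r" for i
  proof -
    have "s i \<le> s'"
      unfolding s'_def using that by (intro member_le_sum) auto
    then show ?thesis
      unfolding m_eq[OF that] by (intro sum.mono_neutral_cong_left) (auto simp: a'_def)
  qed
  then have "F = (\<Sum>i<r. map_matrix ((*) (\<Sum>j<s'. const_poly (a' i j) * power_product k g (\<alpha> i j)))
      (transpose (A i) ** A i))"
    unfolding F by (intro sum.cong) auto
  moreover have "\<forall>i<r. \<forall>j<s'. a' i j \<ge> 0"
    using a by (simp add: a'_def)
  ultimately show ?thesis by blast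
qed

theorem theorem3p1:
  fixes g :: "nat \<Rightarrow> 'v::finite rpoly"
    and m k :: nat
    and F :: "'v rpoly ^ 't::finite ^ 't"
  assumes "1 \<le> m" and "m \<le> k"
    and "\<And>l. l \<in> {1..m} \<Longrightarrow> total_degree (g l) \<le> 1"
    and "nonneg_set (g ` {1..m}) \<noteq> {}"
    and "compact (nonneg_set (g ` {1..m}))"
    and "transpose F = F"
    and "\<And>x. x \<in> nonneg_set (g ` {1..k}) \<Longrightarrow> positive_definite (map_matrix (\<lambda>p. eval_poly p x) F)"
  shows "F \<in> weighted_matrix_squares (generated_semiring k g) \<and>
    (\<exists>(r::nat) (s::nat) (a :: nat \<Rightarrow> nat \<Rightarrow> real) (\<alpha> :: nat \<Rightarrow> nat \<Rightarrow> nat \<Rightarrow> nat)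
        (A :: nat \<Rightarrow> 'v rpoly ^ 't ^ 't).
      (\<forall>i<r. \<forall>j<s. a i j \<ge> 0) \<and>
      F = (\<Sum>i<r. map_matrix ((*) (\<Sum>j<s. const_poly (a i j) * power_product k g (\<alpha> i j)))
                     (transpose (A i) ** A i)))"
proof -
  let ?S = "generated_semiring k g"
  obtain N where N: "N > 0" "\<And>i. const_poly N + coord_poly i \<in> ?S"
    "\<And>i. const_poly N - coord_poly i \<in> ?S"
    using coordinate_bounds_in_generated_semiring[OF assms(2-5)] by blast
  \<comment> \<open>A positive factor preserves the signs of \<open>g l\<close> and, for
    \<open>l\<close> in \<open>{1..k}\<close>, membership in the semiring, while the bound 1 on the
    box is what the penalty estimate requires.\<close>
  have "\<exists>s>0. \<forall>x. (\<forall>i. \<bar>x $ i\<bar> \<le> N) \<longrightarrow> eval_poly (const_poly s * g l) x \<le> 1" for l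
    by (rule exists_scaling_le_1_on_box[of N "g l"]) blast
  then obtain s where s: "\<And>l. s l > 0"
    and le1: "\<And>l x. (\<And>i. \<bar>x $ i\<bar> \<le> N) \<Longrightarrow> eval_poly (const_poly (s l) * g l) x \<le> 1"
    by metis
  define h where "h l = const_poly (s l) * g l" for l
  have h_S: "h l \<in> ?S" if "l \<in> {1..k}" for l
    unfolding h_def using s[of l] that
    by (intro generated_semiring_mult generated_semiring_const generated_semiring_generator) auto
  have "eval_poly (h l) x \<ge> 0 \<longleftrightarrow> eval_poly (g l) x \<ge> 0" for l x
    using s[of l] by (simp add: h_def zero_le_mult_iff)
  then have "nonneg_set (h ` {1..k}) = nonneg_set (g ` {1..k})"
    by (simp add: nonneg_set_def)
  then have pos: "positive_definite (map_matrix (\<lambda>p. eval_poly p x) F)"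
    if "x \<in> nonneg_set (h ` {1..k})" for x
    using that assms(7) by blast
  have h_le1: "\<forall>l\<in>{1..k}. \<forall>x. (\<forall>i. \<bar>x $ i\<bar> \<le> N) \<longrightarrow> eval_poly (h l) x \<le> 1"
    using le1 by (simp add: h_def)
  obtain n \<delta> where "\<delta> > 0" and \<delta>: "\<forall>x v. (\<forall>i. \<bar>x $ i\<bar> \<le> N) \<longrightarrow> norm v = 1 \<longrightarrow>
    v \<bullet> (map_matrix (\<lambda>p. eval_poly p x) F *v v) -
      (\<Sum>l\<in>{1..k}. eval_poly (h l) x * (1 - eval_poly (h l) x) ^ (2 * n)) \<ge> \<delta>"
    by (rule positivity_certificate[OF h_le1 pos N(1)])
  \<comment> \<open>These diagonal matrices make \<open>P\<close> the scalar matrix of the total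
    penalty \<open>p\<close>, written as matrix squares with weights \<open>h l\<close>; subtracting
    \<open>P\<close> lowers the quadratic form by \<open>p\<close> times the squared norm.\<close>
  define D :: "nat \<Rightarrow> 'v rpoly ^ 't ^ 't" where "D l = (\<chi> a b. if a = b then (1 - h l) ^ n else 0)" for l
  define P where "P = (\<Sum>l\<in>{1..k}. map_matrix ((*) (h l)) (transpose (D l) ** D l))"
  define p where "p = (\<Sum>l\<in>{1..k}. h l * (1 - h l) ^ (2 * n))"
  have P_nth: "P $ a $ b = (if a = b then p else 0)" for a b
    by (simp add: P_def p_def D_def transpose_mult_diag mult.commute[of 2 n] flip: power_mult)
  have P_W: "P \<in> weighted_matrix_squares ?S"
    unfolding P_def using h_S by (intro weighted_matrix_squares_sum weighted_matrix_squares_term)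
  have F_sym: "F $ a $ b = F $ b $ a" for a b
    using assms(6) by (rule symmetric_matrix_nth)
  have "F - P \<in> weighted_matrix_squares ?S"
  proof (rule positive_on_box_in_weighted_matrix_squares[OF N _ \<open>\<delta> > 0\<close>])
    show "transpose (F - P) = F - P"
      unfolding vec_eq_iff by (auto simp: transpose_def P_nth F_sym)
  next
    fix x :: "real ^ 'v" and v :: "real ^ 't"
    assume x: "\<And>i. \<bar>x $ i\<bar> \<le> N"
    let ?q = "\<lambda>v. v \<bullet> (map_matrix (\<lambda>p. eval_poly p x) F *v v)"
    have "map_matrix (\<lambda>p. eval_poly p x) (F - P) *v v =
        map_matrix (\<lambda>p. eval_poly p x) F *v v - eval_poly p x *\<^sub>R v"
    proof -
      have "eval_poly (P $ a $ b) x * v $ b = (if b = a then eval_poly p x * v $ b else 0)" for a b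
        by (simp add: P_nth)
      then show ?thesis
        by (simp add: vec_eq_iff matrix_vector_mult_def left_diff_distrib sum_subtractf)
    qed
    then have eq: "v \<bullet> (map_matrix (\<lambda>p. eval_poly p x) (F - P) *v v) =
        ?q v - eval_poly p x * (norm v)\<^sup>2"
      by (simp add: inner_diff_right power2_norm_eq_inner)
    show "v \<bullet> (map_matrix (\<lambda>p. eval_poly p x) (F - P) *v v) \<ge> \<delta> * (norm v)\<^sup>2"
    proof (cases "v = 0")
      case False
      \<comment> \<open>The certificate concerns unit vectors; homogeneity of degree 2 extends it to
        all \<open>v\<close>.\<close>
      define w where "w = v /\<^sub>R norm v"
      have "norm w = 1" "v = norm v *\<^sub>R w"
        using False by (auto simp: w_def)
      then have "?q v = (norm v)\<^sup>2 * ?q w"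
        by (metis (no_types, lifting) inner_scaleR_left inner_scaleR_right matrix_vector_mult_scaleR
            mult.assoc power2_eq_square)
      moreover have "?q w - eval_poly p x \<ge> \<delta>"
        using \<delta> x \<open>norm w = 1\<close> by (simp add: p_def)
      then have "(norm v)\<^sup>2 * (?q w - eval_poly p x) \<ge> (norm v)\<^sup>2 * \<delta>"
        by (intro mult_left_mono) auto
      ultimately show ?thesis
        unfolding eq by (simp add: algebra_simps)
    qed simp
  qed
  from weighted_matrix_squares_add[OF this P_W] have "F \<in> weighted_matrix_squares ?S"
    by simp
  then show ?thesis
    using weighted_matrix_squares_explicit by blast
qed

end
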